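(* Let $X_t = dt-\sum_{j=1}^{N_t}C_j$, $t\ge 0$, where $d>0$, $N$ is a Poisson process with rate $\lambda>0$, and $\{C_j\}_{j\ge1}$ are i.i.d. random variables, independent of $N$, having a matrix-exponential distribution on $(0,\infty)$ with minimal standardized representation $(\boldsymbol{\alpha},\boldsymbol{T})$ of order $p\in\mathbb{N}$, and $\boldsymbol{t}:=-\boldsymbol{T}\boldsymbol{1}$. Let $\psi$ be the Laplace exponent of $X$, and for $q\ge 0$ let $\Phi_q$ be the largest root of $\psi(\theta)=q$ in $[0,\infty)$ and $W^{(q)}$ the $q$-scale function of $X$. Let $q\ge 0$ be such that $\psi'(\Phi_q)>0$. Define row vectors $\boldsymbol{\Psi}_n\in\mathbb{R}^{1\times p}$ by $\boldsymbol{\Psi}_0=\boldsymbol{0}$ and $$\boldsymbol{\Psi}_n:=\Big(\frac{\lambda}{d}\boldsymbol{\alpha}+(\boldsymbol{\Psi}_{n-1}\boldsymbol{t})\,\boldsymbol{\Psi}_{n-1}\Big)\Big(\frac{\lambda+q}{d}\boldsymbol{I}-\boldsymbol{T}\Big)^{-1},\qquad n\ge 1.$$ Then the sequence $(\boldsymbol{\Psi}_n)_{n\ge 0}$ converges entrywise to a vector $\boldsymbol{\Psi}\in\mathbb{R}^{1\times p}$, this $\boldsymbol{\Psi}$ is a solution to $$\boldsymbol{\Psi}\big((\lambda+q)\boldsymbol{I}-d\boldsymbol{T}-d\,\boldsymbol{t}\,\boldsymbol{\Psi}\big)=\lambda\,\boldsymbol{\alpha},$$ and, with $\boldsymbol{G}:=\boldsymbol{T}+\boldsymbol{t}\,\boldsymbol{\Psi}$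 and $\boldsymbol{\nu}:=(\Phi_q\boldsymbol{I}-\boldsymbol{T})^{-1}\boldsymbol{t}$, $$W^{(q)}(x)=\frac{1}{\psi'(\Phi_q)}\Big(e^{\Phi_q x}-\boldsymbol{\Psi}\,e^{\boldsymbol{G}x}\,\boldsymbol{\nu}\Big)\qquad\text{for all } x\ge 0.$$
   Context: A distribution on $(0,\infty)$ is matrix-exponential if it has a density of the form $f(x)=\boldsymbol{\alpha}e^{\boldsymbol{T}x}\boldsymbol{t}$, $x>0$, with $\boldsymbol{\alpha}$ a $1\times p$ row vector, $\boldsymbol{T}$ a $p\times p$ matrix and $\boldsymbol{t}$ a $p\times1$ column vector (no sign constraints on the entries; the only requirement is that $f$ is a probability density). A standardized representation $(\boldsymbol{\alpha},\boldsymbol{T})$ of order $p$ is one with real entries such that $\boldsymbol{\alpha}\boldsymbol{1}=1$ and $\boldsymbol{t}=-\boldsymbol{T}\boldsymbol{1}$, where $\boldsymbol{1}$ is the column vector of ones. It is minimal if the Laplace transform $\boldsymbol{\alpha}(\theta\boldsymbol{I}-\boldsymbol{T})^{-1}\boldsymbol{t}$, written as a ratio $P(\theta)/Q(\theta)$ of polynomials with no common factors, has $\deg Q=p$. $\boldsymbol{I}$ is the identity matrix. The Laplace exponent of $X$ is $\psi(\theta)=\log\mathbb{E}[e^{\theta X_1}]=d\theta+\lambda\big(\boldsymbol{\alpha}(\theta\boldsymbol{I}-\boldsymbol{T})^{-1}\boldsymbol{t}-1\big)$, $\theta\ge 0$ (with $\psi'(0)$ the right derivative at $0$). For $q\ge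 0$, $\Phi_q\ge 0$ is the largest root of $\psi(\theta)=q$. The $q$-scale function $W^{(q)}:\mathbb{R}\to[0,\infty)$ is the function that vanishes on $(-\infty,0)$, is continuous on $[0,\infty)$, and is characterized there by $\int_0^\infty e^{-\theta x}W^{(q)}(x)\,dx=\frac{1}{\psi(\theta)-q}$ for $\theta>\Phi_q$. *)

theory Defs
  imports "HOL-Probability.Probability" "HOL-Computational_Algebra.Polynomial"
begin

text \<open>
  Row and column vectors of length \<open>p = CARD('p)\<close> are both of type \<open>real^'p\<close>: a product
  \<open>\<alpha> A t\<close> is \<open>\<alpha> \<bullet> (A *v t)\<close>, a product \<open>\<alpha> A\<close> is \<open>\<alpha> v* A\<close>, the column of ones
  is \<open>1\<close>, and \<open>\<theta> I\<close> is \<open>mat \<theta>\<close>.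
\<close>

definition outer_prod :: "real^'n \<Rightarrow> real^'m \<Rightarrow> real^'m^'n" where
  "outer_prod u v = (\<chi> i j. u $ i * v $ j)"

text \<open>
  The library multiplication on \<open>real^'n^'n\<close> is entrywise, so its \<open>(^)\<close> is not the matrix
  power and \<open>exp\<close> is unavailable.
\<close>

primrec mat_power :: "real^'n^'n \<Rightarrow> nat \<Rightarrow> real^'n^'n" where
  "mat_power A 0 = mat 1"
| "mat_power A (Suc n) = A ** mat_power A n"

definition mat_exp :: "real^'n^'n \<Rightarrow> real^'n^'n" where
  "mat_exp A = (\<Sum>n. (1 / fact n) *\<^sub>R mat_power A n)"


definition me_density :: "real^'p \<Rightarrow> real^'p^'p \<Rightarrow> real^'p \<Rightarrow> real \<Rightarrow> real" where
  "me_density \<alpha> T t x = (if x > 0 then \<alpha> \<bullet> (mat_exp (x *\<^sub>R T) *v t) else 0)"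

text \<open>
  Nonnegativity is required separately because \<open>ennreal\<close> truncates negative values to \<open>0\<close>;
  that the density integrates to one follows when \<open>M\<close> is a probability space.
\<close>

definition matrix_exponential_rv ::
    "'a measure \<Rightarrow> ('a \<Rightarrow> real) \<Rightarrow> real^'p \<Rightarrow> real^'p^'p \<Rightarrow> real^'p \<Rightarrow> bool" where
  "matrix_exponential_rv M Y \<alpha> T t \<longleftrightarrow>
     (\<forall>x. 0 \<le> me_density \<alpha> T t x) \<and>
     distributed M lborel Y (\<lambda>x. ennreal (me_density \<alpha> T t x))"

definition standardized_rep :: "real^'p \<Rightarrow> real^'p^'p \<Rightarrow> real^'p \<Rightarrow> bool" where
  "standardized_rep \<alpha> T t \<longleftrightarrow> \<alpha> \<bullet> 1 = 1 \<and> t = - (T *v 1)"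

text \<open>
  Equality of rational functions is stated at every real \<open>\<theta>\<close> which is not an eigenvalue of
  \<open>T\<close>, i.e. at all but finitely many points.
\<close>

definition minimal_rep :: "real^'p \<Rightarrow> real^'p^'p \<Rightarrow> real^'p \<Rightarrow> bool" where
  "minimal_rep \<alpha> T t \<longleftrightarrow>
     (\<exists>P Q :: real poly. coprime P Q \<and> degree Q = CARD('p) \<and>
        (\<forall>\<theta>. invertible (mat \<theta> - T) \<longrightarrow>
           poly Q \<theta> \<noteq> 0 \<and>
           \<alpha> \<bullet> (matrix_inv (mat \<theta> - T) *v t) = poly P \<theta> / poly Q \<theta>))"


text \<open>
  Only times \<open>t \<ge> 0\<close> matter. Paths are almost surely nondecreasing, so the truncated
  subtraction on \<open>nat\<close> gives the true increments up to a null set.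
\<close>

locale poisson_process = prob_space M
  for M :: "'a measure" and N :: "real \<Rightarrow> 'a \<Rightarrow> nat" and lam :: real +
  assumes rate_pos: "lam > 0"
    and measurable_count: "\<And>t. 0 \<le> t \<Longrightarrow> N t \<in> M \<rightarrow>\<^sub>M count_space UNIV"
    and start_zero: "AE \<omega> in M. N 0 \<omega> = 0"
    and paths_mono: "AE \<omega> in M. \<forall>s t. 0 \<le> s \<and> s \<le> t \<longrightarrow> N s \<omega> \<le> N t \<omega>"
    and paths_right_continuous:
      "AE \<omega> in M. \<forall>t\<ge>0. continuous (at_right t) (\<lambda>s. N s \<omega>)"
    and independent_increments:
      "\<And>(s :: nat \<Rightarrow> real) n. 0 \<le> s 0 \<Longrightarrow> mono s \<Longrightarrow>
         indep_vars (\<lambda>_. count_space UNIV) (\<lambda>i \<omega>. N (s (Suc i)) \<omega> - N (s i) \<omega>) {..<n}"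
    and poisson_increments:
      "\<And>s t. 0 \<le> s \<Longrightarrow> s < t \<Longrightarrow>
         distr M (count_space UNIV) (\<lambda>\<omega>. N t \<omega> - N s \<omega>) =
         measure_pmf (poisson_pmf (lam * (t - s)))"

text \<open>
  The claims are \<open>C 1, C 2, \<dots>\<close>; the value \<open>C 0\<close> is never used.
  Independence of the counting process and the claim sequence: the generated sigma-algebras
  are independent. (\<open>indep_var\<close> does not apply, as it needs both random elements to have
  values in the same type.)
\<close>

definition indep_count_claims ::
    "'a measure \<Rightarrow> (real \<Rightarrow> 'a \<Rightarrow> nat) \<Rightarrow> (nat \<Rightarrow> 'a \<Rightarrow> real) \<Rightarrow> bool" where
  "indep_count_claims M N C \<longleftrightarrow>
     prob_space.indep_set M
       (sets (vimage_algebra (space M)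
          (\<lambda>\<omega>. \<lambda>s\<in>{0..}. N s \<omega>) (PiM {0..} (\<lambda>_. count_space UNIV))))
       (sets (vimage_algebra (space M)
          (\<lambda>\<omega>. \<lambda>j\<in>{1..}. C j \<omega>) (PiM {1..} (\<lambda>_. borel))))"

definition risk_process ::
    "real \<Rightarrow> (real \<Rightarrow> 'a \<Rightarrow> nat) \<Rightarrow> (nat \<Rightarrow> 'a \<Rightarrow> real) \<Rightarrow> real \<Rightarrow> 'a \<Rightarrow> real" where
  "risk_process d N C t \<omega> = d * t - (\<Sum>j=1..N t \<omega>. C j \<omega>)"

definition laplace_exponent :: "'a measure \<Rightarrow> (real \<Rightarrow> 'a \<Rightarrow> real) \<Rightarrow> real \<Rightarrow> real" where
  "laplace_exponent M X \<theta> = ln (\<integral>\<omega>. exp (\<theta> * X 1 \<omega>) \<partial>M)"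

text \<open>The derivative relative to \<open>[0,\<infinity>)\<close>; at \<open>0\<close> it is the right derivative.\<close>

definition exponent_deriv :: "(real \<Rightarrow> real) \<Rightarrow> real \<Rightarrow> real" where
  "exponent_deriv \<psi> \<theta> = vector_derivative \<psi> (at \<theta> within {0..})"

definition largest_root :: "(real \<Rightarrow> real) \<Rightarrow> real \<Rightarrow> real" where
  "largest_root \<psi> q = (GREATEST \<theta>. 0 \<le> \<theta> \<and> \<psi> \<theta> = q)"

definition is_scale_function :: "(real \<Rightarrow> real) \<Rightarrow> real \<Rightarrow> (real \<Rightarrow> real) \<Rightarrow> bool" where
  "is_scale_function \<psi> q W \<longleftrightarrow>
     (\<forall>x. 0 \<le> W x) \<and>
     (\<forall>x<0. W x = 0) \<and>
     continuous_on {0..} W \<and>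
     (\<forall>\<theta>>largest_root \<psi> q.
        ((\<lambda>x. exp (- \<theta> * x) * W x) has_integral 1 / (\<psi> \<theta> - q)) {0..})"

end

theory Submission
  imports Defs "HOL-Computational_Algebra.Polynomial_Factorial" "HOL-Computational_Algebra.Field_as_Ring"
begin

text \<open>
  Write \<open>\<beta> = \<lambda> / d\<close>, \<open>c = (\<lambda> + q) / d\<close>, \<open>R \<theta> = (\<theta> I - T)\<^bsup>-1\<^esup>\<close>. The limit is explicit: \<open>\<Psi> = \<beta> \<alpha> R \<Phi>\<close>,
  because a fixed point \<open>L\<close> of the iteration satisfies \<open>L (\<gamma> I - T) = \<beta> \<alpha>\<close> with \<open>\<gamma> = c - L t\<close>, and
  multiplying \<open>L = \<beta> \<alpha> R \<gamma>\<close> by \<open>t\<close> turns this into \<open>\<psi> \<gamma> = q\<close>. The iterates increase with respect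
  to the cone of row vectors \<open>u\<close> with \<open>u e\<^bsup>T x\<^esup> t \<ge> 0\<close> for \<open>x > 0\<close>, which every \<open>R \<theta>\<close>, \<open>\<theta> \<ge> 0\<close>, preserves,
  and stay below \<open>\<beta> \<alpha> R \<Phi>\<close>; hence they converge to some \<open>\<beta> \<alpha> R \<gamma>\<close> with \<open>\<gamma> \<ge> \<Phi>\<close> and \<open>\<psi> \<gamma> = q\<close>, and
  \<open>\<gamma> = \<Phi>\<close> since \<open>\<Phi>\<close> is the largest root.

  Minimality enters only through the fact that the vectors \<open>e\<^bsup>T s\<^esup> t\<close>, and likewise \<open>\<alpha> e\<^bsup>T s\<^esup>\<close>, with
  \<open>s > 0\<close> span the whole space. So positivity on the cone controls every coordinate, and every entry of \<open>e\<^bsup>T x\<^esup>\<close> is a linear combination of shifts of the density and is integrable on the half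
  line. This replaces any spectral analysis of \<open>T\<close>.

  The formula for \<open>W\<close> holds because both sides have the same Laplace transform for large \<open>\<theta>\<close>: the
  resolvent of the rank one perturbation \<open>G = T + t \<Psi>\<close> reduces to that of \<open>T\<close>.
\<close>

section \<open>The matrix exponential flow\<close>

lemma norm_mat_power_vec_le:
  fixes A :: "real^'n^'n"
  shows "norm (mat_power A n *v v) \<le> onorm ((*v) A) ^ n * norm v"
proof (induction n)
  case (Suc n)
  have "norm (mat_power A (Suc n) *v v) \<le> onorm ((*v) A) * norm (mat_power A n *v v)"
    by (simp add: matrix_vector_mul_assoc [symmetric] onorm matrix_vector_mul_bounded_linear)
  also have "\<dots> \<le> onorm ((*v) A) * (onorm ((*v) A) ^ n * norm v)"
    by (intro mult_left_mono Suc onorm_pos_le matrix_vector_mul_bounded_linear)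
  finally show ?case by (simp add: mult.assoc)
qed simp

lemma bounded_linear_matrix_vector_left: "bounded_linear (\<lambda>A :: real^'n^'m. A *v v)"
  by (intro linear_conv_bounded_linear [THEN iffD1] linearI)
    (simp_all add: matrix_vector_mult_add_rdistrib scaleR_matrix_vector_assoc)

lemma mat_power_component:
  fixes A :: "real^'n^'n"
  shows "mat_power A n $ i $ j = axis i 1 \<bullet> (mat_power A n *v axis j 1)"
  by (simp add: inner_axis' matrix_vector_mul_component)
    (simp add: inner_axis)

text \<open>Every entry of the n-th power is at most \<open>K ^ n\<close> in modulus, so a multiple
  of the scalar exponential series dominates. Until this is known, the infinite sum in
  \<open>mat_exp\<close> is an unspecified value.\<close>

lemma mat_exp_sums:
  fixes A :: "real^'n^'n"
  shows "(\<lambda>n. (1 / fact n) *\<^sub>R mat_power A n) sums mat_exp A"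
proof -
  define K where "K = onorm ((*v) A)"
  have "norm (mat_power A n) \<le> real (CARD('n) * CARD('n)) * K ^ n" for n
  proof -
    have "\<bar>mat_power A n $ i $ j\<bar> \<le> K ^ n" for i j
    proof -
      have "\<bar>mat_power A n $ i $ j\<bar> \<le> norm (axis i (1::real)) * norm (mat_power A n *v axis j 1)"
        unfolding mat_power_component by (rule Cauchy_Schwarz_ineq2)
      also have "\<dots> \<le> K ^ n"
        using norm_mat_power_vec_le [of A n "axis j 1"] by (simp add: K_def)
      finally show ?thesis .
    qed
    then have "norm (mat_power A n $ i) \<le> real CARD('n) * K ^ n" for i
      using norm_le_l1_cart [of "mat_power A n $ i"] sum_bounded_above [of UNIV "\<lambda>j. \<bar>mat_power A n $ i $ j\<bar>" "K ^ n"]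
      by force
    then have "(\<Sum>i\<in>UNIV. norm (mat_power A n $ i)) \<le> real CARD('n) * (real CARD('n) * K ^ n)"
      by (intro sum_bounded_above) auto
    moreover have "norm (mat_power A n) \<le> (\<Sum>i\<in>UNIV. norm (mat_power A n $ i))"
      unfolding norm_vec_def by (rule L2_set_le_sum) simp
    ultimately show ?thesis by simp
  qed
  then have *: "norm ((1 / fact n) *\<^sub>R mat_power A n)
      \<le> real (CARD('n) * CARD('n)) * (inverse (fact n) * K ^ n)" for n
    by (simp add: field_simps)
  have "summable (\<lambda>n. real (CARD('n) * CARD('n)) * (inverse (fact n) * K ^ n))"
    by (intro summable_mult summable_exp)
  then have "summable (\<lambda>n. (1 / fact n) *\<^sub>R mat_power A n)"
    by (rule summable_comparison_test') (use * in auto)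
  then show ?thesis
    unfolding mat_exp_def by (rule summable_sums)
qed

lemma mat_power_scaleR:
  fixes A :: "real^'n^'n"
  shows "mat_power (c *\<^sub>R A) n = c ^ n *\<^sub>R mat_power A n"
  by (induction n) (simp_all add: matrix_scalar_ac mult.commute flip: scalar_matrix_assoc)

lemma mat_power_commute: "mat_power A n ** A = A ** mat_power A n"
  by (induction n) (simp_all flip: matrix_mul_assoc)

lemma transpose_mat_power:
  fixes A :: "real^'n^'n"
  shows "transpose (mat_power A n) = mat_power (transpose A) n"
  by (induction n) (simp_all add: matrix_transpose_mul mat_power_commute)

text \<open>Acting on a vector keeps the calculus scalar: derivatives are taken of the power series
  of \<open>u \<bullet> flow A x v\<close>.\<close>

definition flow :: "real^'n^'n \<Rightarrow> real \<Rightarrow> real^'n \<Rightarrow> real^'n" where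
  "flow A x v = mat_exp (x *\<^sub>R A) *v v"

lemma flow_sums: "(\<lambda>n. (x ^ n / fact n) *\<^sub>R (mat_power A n *v v)) sums flow A x v"
  using bounded_linear.sums [OF bounded_linear_matrix_vector_left [of v] mat_exp_sums [of "x *\<^sub>R A"]]
  by (simp add: flow_def mat_power_scaleR scaleR_matrix_vector_assoc)

lemma inner_flow_sums:
  "(\<lambda>n. (u \<bullet> (mat_power A n *v v) / fact n) * x ^ n) sums (u \<bullet> flow A x v)"
  using bounded_linear.sums [OF bounded_linear_inner_right [of u] flow_sums [of x A v]]
  by (simp add: mult_ac)

lemma flow_add: "flow A x (u + v) = flow A x u + flow A x v"
  by (simp add: flow_def matrix_vector_right_distrib)

lemma flow_diff: "flow A x (u - v) = flow A x u - flow A x v"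
  by (simp add: flow_def matrix_vector_mult_diff_distrib)

lemma flow_scaleR: "flow A x (c *\<^sub>R v) = c *\<^sub>R flow A x v"
  by (simp add: flow_def matrix_vector_mult_scaleR)

lemma flow_zero_vec [simp]: "flow A x 0 = 0"
  by (simp add: flow_def)

lemma flow_0 [simp]: "flow A 0 v = v"
proof -
  have "(\<lambda>n. (0 ^ n / fact n) *\<^sub>R (mat_power A n *v v)) sums
      ((0 ^ 0 / fact 0) *\<^sub>R (mat_power A 0 *v v))"
    using sums_finite [of "{0}" "\<lambda>n. (0 ^ n / fact n) *\<^sub>R (mat_power A n *v v)"] by simp
  then show ?thesis
    using sums_unique2 [OF flow_sums [of 0 A v]] by simp
qed

text \<open>Termwise in the series, since powers commute with transposition. It lets row vectors
  \<alpha> e^(T x) be treated as a flow of the transposed matrix.\<close>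

lemma flow_transpose: "flow (transpose A) x u \<bullet> v = u \<bullet> flow A x v"
proof -
  have "(mat_power (transpose A) n *v u) \<bullet> v = u \<bullet> (mat_power A n *v v)" for n
    by (metis dot_lmul_matrix inner_commute transpose_mat_power transpose_matrix_vector transpose_transpose)
  then have "(\<lambda>n. (u \<bullet> (mat_power A n *v v) / fact n) * x ^ n) sums (v \<bullet> flow (transpose A) x u)"
    using inner_flow_sums [of v "transpose A" u x] by (simp add: inner_commute)
  then show ?thesis
    using sums_unique2 [OF inner_flow_sums [of u A v x]] by (simp only: inner_commute)
qed

lemma flow_matrix_commute: "flow A x (A *v v) = A *v flow A x v"
proof -
  have "(\<lambda>n. (x ^ n / fact n) *\<^sub>R (mat_power A n *v (A *v v))) sums (A *v flow A x v)"
    using bounded_linear.sums [OF matrix_vector_mul_bounded_linear [of A] flow_sums [of x A v]]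
    by (simp add: matrix_vector_mult_scaleR matrix_vector_mul_assoc mat_power_commute)
  then show ?thesis
    using sums_unique2 [OF flow_sums] by blast
qed

text \<open>Term-by-term differentiation of an entire power series; the index shift in
  \<open>diffs\<close> moves one factor \<open>A\<close> onto \<open>v\<close>.\<close>

lemma inner_flow_has_derivative:
  "((\<lambda>x. u \<bullet> flow A x v) has_field_derivative (u \<bullet> flow A x (A *v v))) (at x within S)"
proof -
  define c where "c n = u \<bullet> (mat_power A n *v v) / fact n" for n
  have c: "(\<lambda>n. c n * x ^ n) sums (u \<bullet> flow A x v)" for x
    unfolding c_def by (rule inner_flow_sums)
  have "diffs c n = u \<bullet> (mat_power A n *v (A *v v)) / fact n" for n
    by (simp add: diffs_def c_def matrix_vector_mul_assoc mat_power_commute)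
  then have "(\<lambda>n. diffs c n * x ^ n) sums (u \<bullet> flow A x (A *v v))"
    using inner_flow_sums [of u A "A *v v" x] by simp
  then have "((\<lambda>x. \<Sum>n. c n * x ^ n) has_field_derivative (u \<bullet> flow A x (A *v v))) (at x)"
    using termdiffs_strong_converges_everywhere [of c x] c by (simp add: sums_iff)
  then show ?thesis
    using c by (simp add: sums_iff has_field_derivative_at_within)
qed

lemma continuous_on_inner_flow: "continuous_on S (\<lambda>x. u \<bullet> flow A x v)"
  by (rule DERIV_continuous_on) (rule inner_flow_has_derivative)

lemma flow_has_vector_derivative:
  "((\<lambda>x. flow A x v) has_vector_derivative (A *v flow A x v)) (at x within S)"
  unfolding has_vector_derivative_def
proof (subst has_derivative_componentwise_within, intro ballI)
  fix i
  show "((\<lambda>x. flow A x v \<bullet> i) has_derivative (\<lambda>y. (y *\<^sub>R (A *v flow A x v)) \<bullet> i)) (at x within S)"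
    using inner_flow_has_derivative [of i A v x S]
    by (simp add: has_field_derivative_def inner_commute flow_matrix_commute mult.commute [of _ "_ \<bullet> _"])
qed

text \<open>Duality: \<open>y\<close> is paired with the adjoint solution that runs backwards and
  equals \<open>w\<close> at time x. The pairing is constant in s, and its values at s = x and s = 0
  are the two sides tested against \<open>w\<close>.\<close>

lemma linear_ode_unique:
  fixes y :: "real \<Rightarrow> real^'n"
  assumes y: "\<And>x. (y has_vector_derivative (A *v y x)) (at x)"
  shows "y x = flow A x (y 0)"
proof (rule vector_eq_ldot [THEN iffD1, rule_format])
  fix w :: "real^'n"
  let ?z = "\<lambda>s. flow (transpose A) (x - s) w"
  have "((\<lambda>s. ?z s \<bullet> y s) has_vector_derivative 0) (at s)" for s
  proof -
    have "((\<lambda>s. x - s) has_vector_derivative (-1)) (at s)"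
      by (auto intro!: derivative_eq_intros)
    from vector_diff_chain_at [OF this flow_has_vector_derivative [of "transpose A" w "x - s" UNIV]]
    have z: "(?z has_vector_derivative (-1) *\<^sub>R (transpose A *v ?z s)) (at s)"
      by (simp add: o_def)
    have "((\<lambda>s. ?z s \<bullet> y s) has_vector_derivative
        (?z s \<bullet> (A *v y s) + ((-1) *\<^sub>R (transpose A *v ?z s)) \<bullet> y s)) (at s)"
      by (rule bounded_bilinear.has_vector_derivative [OF bounded_bilinear_inner z y])
    moreover have "(transpose A *v ?z s) \<bullet> y s = ?z s \<bullet> (A *v y s)"
      by (simp add: dot_lmul_matrix)
    ultimately show ?thesis by simp
  qed
  then have "?z 0 \<bullet> y 0 = ?z x \<bullet> y x"
    using DERIV_isconst_all [of "\<lambda>s. ?z s \<bullet> y s" 0 x]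
    by (simp add: has_real_derivative_iff_has_vector_derivative)
  then show "w \<bullet> y x = w \<bullet> flow A x (y 0)"
    by (simp add: flow_transpose)
qed

text \<open>Both sides solve the same linear equation in x from the same initial vector, so no
  Cauchy product of matrix series is needed.\<close>

lemma flow_plus: "flow A x (flow A s v) = flow A (s + x) v"
proof -
  have "((\<lambda>x. flow A (s + x) v) has_vector_derivative (A *v flow A (s + x) v)) (at x)" for x
  proof -
    have "((\<lambda>x. s + x) has_vector_derivative 1) (at x)"
      by (auto intro!: derivative_eq_intros)
    from vector_diff_chain_at [OF this flow_has_vector_derivative [of A v "s + x" UNIV]]
    show ?thesis by (simp add: o_def)
  qed
  from linear_ode_unique [OF this, of x] show ?thesis
    by simp
qed

lemma norm_flow_le: "norm (flow A x v) \<le> exp (\<bar>x\<bar> * onorm ((*v) A)) * norm v"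
proof -
  let ?K = "onorm ((*v) A)"
  have "norm ((x ^ n / fact n) *\<^sub>R (mat_power A n *v v)) \<le> ((\<bar>x\<bar> * ?K) ^ n /\<^sub>R fact n) * norm v" for n
  proof -
    have "norm ((x ^ n / fact n) *\<^sub>R (mat_power A n *v v)) = (\<bar>x\<bar> ^ n / fact n) * norm (mat_power A n *v v)"
      by (simp add: power_abs)
    also have "\<dots> \<le> (\<bar>x\<bar> ^ n / fact n) * (?K ^ n * norm v)"
      by (intro mult_left_mono norm_mat_power_vec_le) simp
    finally show ?thesis
      by (simp add: power_mult_distrib divide_inverse mult_ac)
  qed
  moreover have "(\<lambda>n. ((\<bar>x\<bar> * ?K) ^ n /\<^sub>R fact n) * norm v) sums (exp (\<bar>x\<bar> * ?K) * norm v)"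
    using sums_mult2 [OF exp_converges] .
  ultimately show ?thesis
    by (rule norm_sums_le [OF flow_sums, rotated])
qed

section \<open>Resolvents and minimality\<close>

lemma mat_vector_mult: "(mat c :: real^'n^'n) *v v = c *\<^sub>R v"
  by (simp add: vec_eq_iff matrix_vector_mult_def mat_def if_distrib if_distribR cong: if_cong)

lemma invertible_if_ker_trivial:
  fixes A :: "real^'n^'n"
  assumes "\<And>v. A *v v = 0 \<Longrightarrow> v = 0"
  shows "invertible A"
  using assms by (simp add: invertible_left_inverse matrix_left_invertible_ker)

lemma matrix_inv_vector:
  assumes "invertible A"
  shows "A *v (matrix_inv A *v v) = v" and "matrix_inv A *v (A *v v) = v"
proof -
  have "A ** matrix_inv A = mat 1 \<and> matrix_inv A ** A = mat 1"
    using assms unfolding invertible_def matrix_inv_def by (rule someI_ex)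
  then show "A *v (matrix_inv A *v v) = v" "matrix_inv A *v (A *v v) = v"
    by (simp_all add: matrix_vector_mul_assoc)
qed

definition resolvent :: "real^'n^'n \<Rightarrow> real \<Rightarrow> real^'n^'n" where
  "resolvent A \<theta> = matrix_inv (mat \<theta> - A)"

lemma resolvent_right:
  assumes "invertible (mat \<theta> - A)"
  shows "A *v (resolvent A \<theta> *v v) = \<theta> *\<^sub>R (resolvent A \<theta> *v v) - v"
  using matrix_inv_vector(1) [OF assms, of v]
  by (simp add: resolvent_def matrix_vector_mult_diff_rdistrib mat_vector_mult algebra_simps)

lemma resolvent_left:
  assumes "invertible (mat \<theta> - A)"
  shows "resolvent A \<theta> *v (A *v v) = \<theta> *\<^sub>R (resolvent A \<theta> *v v) - v"
  using matrix_inv_vector(2) [OF assms, of v]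
  by (simp add: resolvent_def matrix_vector_mult_diff_rdistrib mat_vector_mult
      matrix_vector_mult_diff_distrib matrix_vector_mult_scaleR algebra_simps)

lemma resolvent_eqI:
  assumes "invertible (mat \<theta> - A)" and "\<theta> *\<^sub>R v - A *v v = w"
  shows "v = resolvent A \<theta> *v w"
  using matrix_inv_vector(2) [OF assms(1), of v] assms(2)
  by (simp add: resolvent_def matrix_vector_mult_diff_rdistrib mat_vector_mult)

lemma invertible_transpose_resolvent:
  fixes A :: "real^'n^'n"
  assumes "invertible (mat \<theta> - A)"
  shows "invertible (mat \<theta> - transpose A)"
proof -
  have "mat \<theta> - transpose A = transpose (mat \<theta> - A)"
    by (simp add: vec_eq_iff transpose_def mat_def)
  moreover obtain B where B: "(mat \<theta> - A) ** B = mat 1" "B ** (mat \<theta> - A) = mat 1"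
    using assms unfolding invertible_def by blast
  have "transpose (mat \<theta> - A) ** transpose B = mat 1" "transpose B ** transpose (mat \<theta> - A) = mat 1"
    by (simp_all add: B flip: matrix_transpose_mul)
  ultimately show ?thesis
    unfolding invertible_def by metis
qed

text \<open>Each resolvent vector solves a linear equation; moving \<open>A\<close> across the inner
  product of the two solutions and cancelling the \<theta> terms leaves the claim.\<close>

lemma resolvent_transpose:
  assumes "invertible (mat \<theta> - A)"
  shows "u \<bullet> (resolvent A \<theta> *v v) = v \<bullet> (resolvent (transpose A) \<theta> *v u)"
proof -
  let ?z = "resolvent (transpose A) \<theta> *v u" and ?y = "resolvent A \<theta> *v v"
  have "transpose A *v ?z = \<theta> *\<^sub>R ?z - u"
    using assms by (intro resolvent_right invertible_transpose_resolvent)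
  moreover have "A *v ?y = \<theta> *\<^sub>R ?y - v"
    by (rule resolvent_right [OF assms])
  moreover have "(transpose A *v ?z) \<bullet> ?y = ?z \<bullet> (A *v ?y)"
    by (simp only: transpose_matrix_vector dot_lmul_matrix)
  ultimately show ?thesis
    by (simp add: inner_diff_left inner_diff_right inner_commute)
qed

lemma invertible_mat_minus_large:
  fixes A :: "real^'n^'n"
  assumes "\<theta> > onorm ((*v) A)"
  shows "invertible (mat \<theta> - A)"
proof (rule invertible_if_ker_trivial)
  fix v :: "real^'n"
  assume "(mat \<theta> - A) *v v = 0"
  then have "A *v v = \<theta> *\<^sub>R v"
    by (simp add: matrix_vector_mult_diff_rdistrib mat_vector_mult)
  then have "\<bar>\<theta>\<bar> * norm v \<le> onorm ((*v) A) * norm v"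
    using onorm [OF matrix_vector_mul_bounded_linear, of A v] by simp
  then have "norm v \<le> 0"
    using assms by (cases "norm v = 0") auto
  then show "v = 0" by simp
qed

section \<open>Minimality implies that the Krylov vectors span\<close>

text \<open>As many vectors as the dimension, all in the hyperplane orthogonal to \<open>w\<close>,
  are dependent. The relation is indexed by positions while \<open>dependent\<close> concerns a set
  of values, so repeated vectors form a separate case.\<close>

lemma linear_relation_if_not_spanning:
  fixes v :: "nat \<Rightarrow> real^'n"
  assumes w: "w \<noteq> 0" "\<And>k. w \<bullet> v k = 0"
  obtains c k where "k < CARD('n)" "c k \<noteq> 0" "(\<Sum>i<CARD('n). c i *\<^sub>R v i) = 0"
proof (cases "inj_on v {..<CARD('n)}")
  case True
  let ?B = "v ` {..<CARD('n)}"
  have card: "card ?B = CARD('n)"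
    using True by (simp add: card_image)
  have "dependent ?B"
  proof (rule ccontr)
    assume "independent ?B"
    then have "dim ?B = DIM(real^'n)"
      using card by (simp add: dim_eq_card_independent)
    then have "span ?B = UNIV"
      using dim_eq_full by blast
    then have "w \<in> span ?B"
      by simp
    then have "orthogonal w w"
      by (rule orthogonal_to_span) (auto simp: orthogonal_def w)
    then show False
      using w by (simp add: orthogonal_def)
  qed
  then obtain u y where u: "y \<in> ?B" "u y \<noteq> 0" "(\<Sum>y\<in>?B. u y *\<^sub>R y) = 0"
    by (auto simp: dependent_finite)
  then obtain k where k: "k < CARD('n)" "y = v k"
    by auto
  show ?thesis
    by (rule that [of k "u \<circ> v"]) (use u k True in \<open>simp_all add: sum.reindex\<close>)
next
  case False
  then obtain i j where ij: "i < CARD('n)" "j < CARD('n)" "i \<noteq> j" "v i = v j"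
    by (auto simp: inj_on_def)
  \<comment> \<open>A repeated vector gives the relation with coefficient 1 at one position and -1
    at the other.\<close>
  let ?c = "\<lambda>m. (if m = i then 1 else 0) - (if m = j then 1 else 0 :: real)"
  have "(\<Sum>m<CARD('n). ?c m *\<^sub>R v m) = 0"
    using ij by (simp add: scaleR_diff_left sum_subtractf if_distribR if_distrib [of "\<lambda>r. r *\<^sub>R _"] cong: if_cong)
  then show ?thesis
    using ij by (intro that [of i ?c]) auto
qed

text \<open>Up to a polynomial, multiplying the vector by \<open>A\<close> multiplies the transform by \<open>\<theta>\<close>. Hence a linear
  relation among the Krylov vectors \<open>T\<^bsup>k\<^esup> t\<close> gives a denominator of the transform of too small a degree.\<close>

lemma krylov_transfer:
  fixes \<alpha> t :: "real^'n"
  shows "\<exists>N. \<forall>\<theta>. invertible (mat \<theta> - A) \<longrightarrow>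
    \<alpha> \<bullet> (resolvent A \<theta> *v (mat_power A k *v t)) = \<theta> ^ k * (\<alpha> \<bullet> (resolvent A \<theta> *v t)) - poly N \<theta>"
proof (induction k)
  case 0
  show ?case by (intro exI [of _ 0]) simp
next
  case (Suc k)
  then obtain N where N: "\<And>\<theta>. invertible (mat \<theta> - A) \<Longrightarrow>
    \<alpha> \<bullet> (resolvent A \<theta> *v (mat_power A k *v t)) = \<theta> ^ k * (\<alpha> \<bullet> (resolvent A \<theta> *v t)) - poly N \<theta>"
    by blast
  show ?case
  proof (intro exI [of _ "pCons (\<alpha> \<bullet> (mat_power A k *v t)) N"] allI impI)
    fix \<theta>
    assume inv: "invertible (mat \<theta> - A)"
    have "mat_power A (Suc k) *v t = A *v (mat_power A k *v t)"
      by (simp add: matrix_vector_mul_assoc)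
    then have "\<alpha> \<bullet> (resolvent A \<theta> *v (mat_power A (Suc k) *v t)) =
        \<theta> * (\<alpha> \<bullet> (resolvent A \<theta> *v (mat_power A k *v t))) - \<alpha> \<bullet> (mat_power A k *v t)"
      by (simp only: resolvent_left [OF inv] inner_diff_right inner_scaleR_right)
    then show "\<alpha> \<bullet> (resolvent A \<theta> *v (mat_power A (Suc k) *v t)) =
        \<theta> ^ Suc k * (\<alpha> \<bullet> (resolvent A \<theta> *v t)) - poly (pCons (\<alpha> \<bullet> (mat_power A k *v t)) N) \<theta>"
      by (simp add: N [OF inv] algebra_simps)
  qed
qed

text \<open>A relation with coefficient polynomial r turns, through \<open>krylov_transfer\<close>,
  into r P / Q = n with n a polynomial. Coprimality then gives that Q divides r, which is nonzero of
  degree below p = deg Q.\<close>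

lemma minimal_rep_controllable:
  fixes \<alpha> t :: "real^'p"
  assumes min: "minimal_rep \<alpha> T t" and w: "\<And>k. w \<bullet> (mat_power T k *v t) = 0"
  shows "w = 0"
proof (rule ccontr)
  assume "w \<noteq> 0"
  then obtain c k where c: "k < CARD('p)" "c k \<noteq> 0"
      "(\<Sum>i<CARD('p). c i *\<^sub>R (mat_power T i *v t)) = 0"
    using linear_relation_if_not_spanning [of w "\<lambda>k. mat_power T k *v t"] w by metis
  obtain P Q :: "real poly" where PQ: "coprime P Q" "degree Q = CARD('p)"
    "\<And>\<theta>. invertible (mat \<theta> - T) \<Longrightarrow> poly Q \<theta> \<noteq> 0 \<and> \<alpha> \<bullet> (resolvent T \<theta> *v t) = poly P \<theta> / poly Q \<theta>"
    using min unfolding minimal_rep_def resolvent_def by blast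
  obtain N where N: "\<And>i \<theta>. invertible (mat \<theta> - T) \<Longrightarrow>
    \<alpha> \<bullet> (resolvent T \<theta> *v (mat_power T i *v t)) = \<theta> ^ i * (\<alpha> \<bullet> (resolvent T \<theta> *v t)) - poly (N i) \<theta>"
    using krylov_transfer [of T \<alpha> _ t] by metis
  define r where "r = (\<Sum>i<CARD('p). monom (c i) i)"
  define n where "n = (\<Sum>i<CARD('p). smult (c i) (N i))"
  \<comment> \<open>The identity is available only beyond the operator norm of \<open>T\<close>, but
    infinitely many roots force the polynomial to vanish.\<close>
  have "poly (r * P - n * Q) \<theta> = 0" if "\<theta> > onorm ((*v) T)" for \<theta>
  proof -
    have inv: "invertible (mat \<theta> - T)"
      using that by (rule invertible_mat_minus_large)
    have "0 = \<alpha> \<bullet> (resolvent T \<theta> *v (\<Sum>i<CARD('p). c i *\<^sub>R (mat_power T i *v t)))"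
      using c by simp
    also have "\<dots> = (\<Sum>i<CARD('p). c i * (\<alpha> \<bullet> (resolvent T \<theta> *v (mat_power T i *v t))))"
      by (simp add: linear_sum [OF matrix_vector_mul_linear] inner_sum_right matrix_vector_mult_scaleR)
    also have "\<dots> = poly r \<theta> * (\<alpha> \<bullet> (resolvent T \<theta> *v t)) - poly n \<theta>"
      by (simp add: N [OF inv] r_def n_def poly_sum poly_monom right_diff_distrib sum_subtractf
          sum_distrib_right mult.assoc)
    finally show ?thesis
      using PQ(3) [OF inv] by (simp add: field_simps)
  qed
  then have "{onorm ((*v) T)<..} \<subseteq> {\<theta>. poly (r * P - n * Q) \<theta> = 0}"
    by auto
  then have "r * P - n * Q = 0"
    using poly_roots_finite [of "r * P - n * Q"] finite_subset infinite_Ioi by blast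
  then have "Q dvd r * P"
    by simp
  then have "Q dvd r"
    using PQ(1) by (simp add: coprime_commute coprime_dvd_mult_left_iff)
  have coeff: "coeff r i = (if i < CARD('p) then c i else 0)" for i
    by (simp add: r_def coeff_sum coeff_monom)
  then have "r \<noteq> 0"
    using c by (metis coeff_0)
  moreover have "degree r < CARD('p)"
    using coeff \<open>r \<noteq> 0\<close> by (metis leading_coeff_0_iff)
  ultimately show False
    using dvd_imp_degree_le [OF \<open>Q dvd r\<close>] PQ(2) by simp
qed

text \<open>Exchanging \<alpha> and t and transposing \<open>T\<close> leaves the rational function
  P / Q unchanged. Spanning results for columns thereby also hold for rows.\<close>

lemma minimal_rep_transpose:
  assumes "minimal_rep \<alpha> T t"
  shows "minimal_rep t (transpose T) \<alpha>"
proof -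
  have "invertible (mat \<theta> - T)" if "invertible (mat \<theta> - transpose T)" for \<theta>
    using invertible_transpose_resolvent [OF that] by simp
  then show ?thesis
    using assms resolvent_transpose [of _ T \<alpha> t] unfolding minimal_rep_def resolvent_def by metis
qed

section \<open>Laplace transforms of the flow\<close>

text \<open>A nonzero limit keeps the modulus above half of its absolute value on a tail, so
  integrals over windows of length n grow linearly in n.\<close>

lemma absolutely_integrable_tendsto_0:
  fixes f :: "real \<Rightarrow> real"
  assumes f: "f absolutely_integrable_on {0..}" and lim: "(f \<longlongrightarrow> l) at_top"
  shows "l = 0"
proof (rule ccontr)
  assume "l \<noteq> 0"
  have "((\<lambda>x. \<bar>f x\<bar>) \<longlongrightarrow> \<bar>l\<bar>) at_top"
    using lim by (rule tendsto_rabs)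
  then have "eventually (\<lambda>x. \<bar>f x\<bar> > \<bar>l\<bar> / 2) at_top"
    using \<open>l \<noteq> 0\<close> by (intro order_tendstoD) auto
  then obtain X where X: "\<And>x. x \<ge> X \<Longrightarrow> \<bar>f x\<bar> > \<bar>l\<bar> / 2" "X \<ge> 0"
    unfolding eventually_at_top_linorder by (metis dual_order.trans linorder_linear)
  let ?g = "\<lambda>x. \<bar>f x\<bar>"
  have g: "?g absolutely_integrable_on {0..}"
    using absolutely_integrable_norm [OF f] by (simp add: o_def)
  have "n * (\<bar>l\<bar> / 2) \<le> integral {0..} ?g" if "n \<ge> 0" for n :: real
  proof -
    have gn: "?g integrable_on {X..X + n}"
      using g X(2) by (intro set_lebesgue_integral_eq_integral set_integrable_subset [OF g]) auto
    have "n * (\<bar>l\<bar> / 2) = integral {X..X + n} (\<lambda>x. \<bar>l\<bar> / 2)"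
      using that by simp
    also have "\<dots> \<le> integral {X..X + n} ?g"
      using X(1) gn by (intro integral_le) (auto intro: less_imp_le)
    also have "\<dots> \<le> integral {0..} ?g"
      using X(2) by (intro integral_subset_le gn set_lebesgue_integral_eq_integral g) auto
    finally show ?thesis .
  qed
  \<comment> \<open>The chosen length makes the lower bound exceed the integral by one; the instance
    0 shows that this length is nonnegative.\<close>
  from this [of "(integral {0..} ?g + 1) / (\<bar>l\<bar> / 2)"] this [of 0] show False
    using \<open>l \<noteq> 0\<close> by simp
qed

text \<open>The boundary term at infinity vanishes because the antiderivative is itself integrable.\<close>

lemma has_integral_atLeast_FTC:
  fixes F f :: "real \<Rightarrow> real"
  assumes deriv: "\<And>x. x \<ge> 0 \<Longrightarrow> (F has_field_derivative f x) (at x)"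
    and f: "f absolutely_integrable_on {0..}" and F: "F absolutely_integrable_on {0..}"
  shows "(f has_integral - F 0) {0..}"
proof -
  let ?I = "integral {0..} f"
  have eq: "set_lebesgue_integral lebesgue {0..b} f = F b - F 0" if "b \<ge> 0" for b
  proof -
    have "(f has_integral (F b - F 0)) {0..b}"
      using that deriv by (intro fundamental_theorem_of_calculus)
        (auto simp: has_real_derivative_iff_has_vector_derivative [symmetric] intro: DERIV_subset)
    moreover have "f absolutely_integrable_on {0..b}"
      by (rule set_integrable_subset [OF f]) auto
    ultimately show ?thesis
      by (simp add: set_lebesgue_integral_eq_integral(2) integral_unique)
  qed
  have "((\<lambda>b. set_lebesgue_integral lebesgue {0..b} f) \<longlongrightarrow> set_lebesgue_integral lebesgue {0..} f) at_top"
    by (rule tendsto_set_lebesgue_integral_at_top [OF _ f]) auto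
  then have "((\<lambda>b. F b - F 0) \<longlongrightarrow> ?I) at_top"
    using eq by (subst (asm) filterlim_cong [OF refl refl])
      (auto simp: eventually_at_top_linorder set_lebesgue_integral_eq_integral(2) [OF f])
  then have "((\<lambda>b. F b - F 0 + F 0) \<longlongrightarrow> ?I + F 0) at_top"
    by (intro tendsto_add tendsto_const)
  then have "?I + F 0 = 0"
    by (intro absolutely_integrable_tendsto_0 [OF F]) simp
  then have "?I = - F 0"
    by simp
  then show ?thesis
    using set_lebesgue_integral_eq_integral(1) [OF f] integrable_integral by metis
qed

lemma flow_eigenvector:
  assumes "A *v v = \<theta> *\<^sub>R v"
  shows "flow A x v = exp (\<theta> * x) *\<^sub>R v"
proof -
  have "((\<lambda>x. exp (\<theta> * x) *\<^sub>R v) has_vector_derivative (A *v (exp (\<theta> * x) *\<^sub>R v))) (at x)" for x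
    unfolding matrix_vector_mult_scaleR assms
    by (auto intro!: derivative_eq_intros simp: has_vector_derivative_def)
  from linear_ode_unique [OF this, of x] show ?thesis
    by simp
qed

text \<open>A kernel vector \<open>v\<close> of \<open>\<theta> I - A\<close> would make \<open>exp (- \<theta> x) (v \<bullet> e\<^bsup>A x\<^esup> v)\<close> a nonzero constant.\<close>

lemma laplace_flow_invertible:
  fixes A :: "real^'n^'n"
  assumes int: "\<And>u v. (\<lambda>x. exp (- \<theta> * x) * (u \<bullet> flow A x v)) absolutely_integrable_on {0..}"
  shows "invertible (mat \<theta> - A)"
proof (rule invertible_if_ker_trivial)
  fix v :: "real^'n"
  assume "(mat \<theta> - A) *v v = 0"
  then have "A *v v = \<theta> *\<^sub>R v"
    by (simp add: matrix_vector_mult_diff_rdistrib mat_vector_mult)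
  then have "exp (- \<theta> * x) * (v \<bullet> flow A x v) = v \<bullet> v" for x
    by (simp add: flow_eigenvector [of A v \<theta>] exp_minus)
  then have "v \<bullet> v = 0"
    using int [of v v] by (intro absolutely_integrable_tendsto_0 [of "\<lambda>_. v \<bullet> v"]) simp_all
  then show "v = 0" by simp
qed

text \<open>The resolvent supplies the antiderivative - e^(-\<theta> x) u e^(A x) R v. It has the
  same form as the integrand, hence is integrable itself, and its value at 0 gives the
  transform.\<close>

lemma laplace_flow:
  fixes A :: "real^'n^'n"
  assumes int: "\<And>u v. (\<lambda>x. exp (- \<theta> * x) * (u \<bullet> flow A x v)) absolutely_integrable_on {0..}"
  shows "((\<lambda>x. exp (- \<theta> * x) * (u \<bullet> flow A x v)) has_integral (u \<bullet> (resolvent A \<theta> *v v))) {0..}"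
proof -
  have inv: "invertible (mat \<theta> - A)"
    using int by (rule laplace_flow_invertible)
  let ?r = "resolvent A \<theta> *v v"
  let ?F = "\<lambda>x. exp (- \<theta> * x) * (- u \<bullet> flow A x ?r)"
  have "(?F has_field_derivative exp (- \<theta> * x) * (u \<bullet> flow A x v)) (at x)" for x
  proof -
    have eq: "u \<bullet> flow A x (A *v ?r) = \<theta> * (u \<bullet> flow A x ?r) - u \<bullet> flow A x v"
      by (simp add: resolvent_right [OF inv] flow_diff flow_scaleR inner_diff_right)
    show ?thesis
      by (auto intro!: derivative_eq_intros inner_flow_has_derivative simp: eq algebra_simps)
  qed
  from has_integral_atLeast_FTC [OF this int int]
  show ?thesis by simp
qed

text \<open>The crude growth bound \<open>norm_flow_le\<close> suffices here. It serves for the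
  perturbed matrix \<open>G\<close>, whose flow need not be integrable on its own.\<close>

lemma laplace_flow_integrable_large:
  fixes A :: "real^'n^'n"
  assumes "\<theta> > onorm ((*v) A)"
  shows "(\<lambda>x. exp (- \<theta> * x) * (u \<bullet> flow A x v)) absolutely_integrable_on {0..}"
proof (rule measurable_bounded_by_integrable_imp_absolutely_integrable)
  let ?K = "onorm ((*v) A)"
  show "(\<lambda>x. exp (- \<theta> * x) * (u \<bullet> flow A x v)) \<in> borel_measurable (lebesgue_on {0..})"
    by (intro continuous_imp_measurable_on_sets_lebesgue continuous_intros continuous_on_inner_flow) simp
  have "(\<lambda>x. exp (- (\<theta> - ?K) * x)) integrable_on {0..}"
    using has_integral_exp_minus_to_infinity [of "\<theta> - ?K" 0] assms by (auto simp: integrable_on_def)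
  then show "(\<lambda>x. (norm u * norm v) * exp (- (\<theta> - ?K) * x)) integrable_on {0..}"
    by (rule integrable_on_mult_right)
  fix x :: real
  assume x: "x \<in> {0..}"
  have "\<bar>u \<bullet> flow A x v\<bar> \<le> norm u * (exp (\<bar>x\<bar> * ?K) * norm v)"
    using Cauchy_Schwarz_ineq2 [of u "flow A x v"] norm_flow_le [of A x v]
    by (meson mult_left_mono norm_ge_zero order_trans)
  then have "exp (- \<theta> * x) * \<bar>u \<bullet> flow A x v\<bar> \<le> exp (- \<theta> * x) * (norm u * (exp (\<bar>x\<bar> * ?K) * norm v))"
    by (intro mult_left_mono) auto
  also have "\<dots> = (norm u * norm v) * (exp (- \<theta> * x) * exp (x * ?K))"
    using x by simp
  also have "exp (- \<theta> * x) * exp (x * ?K) = exp (- (\<theta> - ?K) * x)"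
    by (simp add: algebra_simps flip: exp_add)
  finally show "norm (exp (- \<theta> * x) * (u \<bullet> flow A x v)) \<le> (norm u * norm v) * exp (- (\<theta> - ?K) * x)"
    by (simp add: abs_mult)
qed auto

lemma laplace_flow_integrable_mono:
  fixes A :: "real^'n^'n"
  assumes int: "(\<lambda>x. u \<bullet> flow A x v) absolutely_integrable_on {0..}" and "\<theta> \<ge> 0"
  shows "(\<lambda>x. exp (- \<theta> * x) * (u \<bullet> flow A x v)) absolutely_integrable_on {0..}"
proof (rule absolutely_integrable_bounded_measurable_product_real [OF _ _ _ int])
  show "(\<lambda>x. exp (- \<theta> * x)) \<in> borel_measurable (lebesgue_on {0..})"
    by (intro continuous_imp_measurable_on_sets_lebesgue continuous_intros) simp
  show "bounded ((\<lambda>x. exp (- \<theta> * x)) ` {0..})"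
    by (intro boundedI [of _ 1]) (use assms in auto)
qed auto

lemma inner_flow_tendsto_at_right_0: "((\<lambda>s. w \<bullet> flow A s v) \<longlongrightarrow> w \<bullet> v) (at_right 0)"
  using continuous_on_inner_flow [of "{0..}" w A v]
  unfolding continuous_on_def by (metis at_within_Ici_at_right atLeast_iff flow_0 order_refl)

section \<open>Spanning by the flow and integrability of every matrix entry\<close>

text \<open>Repeated differentiation in s on the open half line and then s tending to 0 show that
  \<open>w\<close> is orthogonal to every Krylov vector.\<close>

lemma zero_if_orthogonal_flow:
  assumes min: "minimal_rep \<alpha> T t" and w: "\<And>s. s > 0 \<Longrightarrow> w \<bullet> flow T s t = 0"
  shows "w = 0"
proof (rule minimal_rep_controllable [OF min])
  fix k
  have "\<forall>s>0. w \<bullet> flow T s (mat_power T k *v t) = 0"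
  proof (induction k)
    case (Suc k)
    show ?case
    proof (intro allI impI)
      fix s :: real
      assume s: "s > 0"
      have "((\<lambda>s. 0) has_field_derivative (w \<bullet> flow T s (T *v (mat_power T k *v t)))) (at s)"
        by (rule has_field_derivative_transform_within_open [OF inner_flow_has_derivative, where S = "{0<..}"])
          (use Suc s in auto)
      then have "w \<bullet> flow T s (T *v (mat_power T k *v t)) = 0"
        using DERIV_unique DERIV_const by blast
      then show "w \<bullet> flow T s (mat_power T (Suc k) *v t) = 0"
        by (simp add: matrix_vector_mul_assoc)
    qed
  qed (simp add: w)
  then have "eventually (\<lambda>s. 0 = w \<bullet> flow T s (mat_power T k *v t)) (at_right 0)"
    by (simp add: eventually_at_filter)
  from Lim_transform_eventually [OF tendsto_const this]
  have "((\<lambda>s. w \<bullet> flow T s (mat_power T k *v t)) \<longlongrightarrow> 0) (at_right 0)" .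
  then show "w \<bullet> (mat_power T k *v t) = 0"
    using tendsto_unique [OF trivial_limit_at_right_real inner_flow_tendsto_at_right_0] by blast
qed

lemma span_flow:
  assumes "minimal_rep \<alpha> T t"
  shows "span {flow T s t | s. s > 0} = UNIV"
proof (rule ccontr)
  assume "span {flow T s t | s. s > 0} \<noteq> UNIV"
  then obtain w where "w \<noteq> 0" "span {flow T s t | s. s > 0} \<subseteq> {x. w \<bullet> x = 0}"
    using span_not_UNIV_orthogonal by blast
  then have "w \<bullet> flow T s t = 0" if "s > 0" for s
    using that span_base [of "flow T s t" "{flow T s t | s. s > 0}"] by auto
  then show False
    using zero_if_orthogonal_flow [OF assms] \<open>w \<noteq> 0\<close> by blast
qed

text \<open>Integrability spreads from the density by linearity: first the column vector runs
  through the span of the e^(T s) t, then the row vector through the span of the \<alpha> e^(T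
  s).\<close>

lemma flow_integrable:
  fixes \<alpha> t :: "real^'p"
  assumes min: "minimal_rep \<alpha> T t" and f: "integrable lborel (me_density \<alpha> T t)"
  shows "(\<lambda>x. u \<bullet> flow T x v) absolutely_integrable_on {0..}"
proof -
  \<comment> \<open>A positive shift keeps the argument off 0, where \<open>me_density\<close>
    departs from the exponential formula.\<close>
  have f_shift: "(\<lambda>x. \<alpha> \<bullet> flow T (x + c) t) absolutely_integrable_on {0..}" if "c > 0" for c
  proof -
    have "integrable lborel (\<lambda>x. me_density \<alpha> T t (c + 1 * x))"
      using f by (rule lborel_integrable_real_affine) simp
    then have "integrable lebesgue (\<lambda>x. me_density \<alpha> T t (c + x))"
      by (simp add: integrable_completion)
    then have "(\<lambda>x. me_density \<alpha> T t (c + x)) absolutely_integrable_on {0..}"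
      unfolding set_integrable_def by (intro integrable_mult_indicator) auto
    then show ?thesis
      by (rule absolutely_integrable_spike [of _ _ "{}"])
        (use that in \<open>auto simp: me_density_def flow_def add.commute\<close>)
  qed
  \<comment> \<open>The positive shift is kept for now; the flow time of the row vector takes its
    place in the second induction.\<close>
  have v: "(\<lambda>x. \<alpha> \<bullet> flow T (x + c) v) absolutely_integrable_on {0..}" if c: "c > 0" for c v
  proof -
    have "v \<in> span {flow T s t | s. s > 0}"
      using span_flow [OF min] by simp
    then show ?thesis
    proof (induction rule: span_induct_alt)
      case base
      then show ?case by (simp add: set_integrable_def)
    next
      case (step r x y)
      then obtain s where s: "s > 0" "x = flow T s t"
        by blast
      have "(\<lambda>z. r * (\<alpha> \<bullet> flow T (z + (s + c)) t) + \<alpha> \<bullet> flow T (z + c) y) absolutely_integrable_on {0..}"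
        using s c step by (intro set_integral_add set_integrable_mult_right f_shift) auto
      then show ?case
        by (simp add: s flow_add flow_scaleR flow_plus inner_add_right add_ac)
    qed
  qed
  have "u \<in> span {flow (transpose T) s \<alpha> | s. s > 0}"
    using span_flow [OF minimal_rep_transpose [OF min]] by simp
  then show ?thesis
  proof (induction rule: span_induct_alt)
    case base
    then show ?case by (simp add: set_integrable_def)
  next
    case (step r x y)
    then obtain s where s: "s > 0" "x = flow (transpose T) s \<alpha>"
      by blast
    have "(\<lambda>z. r * (\<alpha> \<bullet> flow T (z + s) v) + y \<bullet> flow T z v) absolutely_integrable_on {0..}"
      using s step by (intro set_integral_add set_integrable_mult_right v) auto
    then show ?case
      by (simp add: s flow_transpose flow_plus inner_add_left add_ac)
  qed
qed

section \<open>The Riccati iteration\<close>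

lemma resolvent_identity:
  assumes "invertible (mat \<theta> - A)" and "invertible (mat \<phi> - A)"
  shows "resolvent A \<theta> *v v - resolvent A \<phi> *v v = (\<phi> - \<theta>) *\<^sub>R (resolvent A \<theta> *v (resolvent A \<phi> *v v))"
proof -
  have "A *v (resolvent A \<phi> *v v) = \<phi> *\<^sub>R (resolvent A \<phi> *v v) - v"
    by (rule resolvent_right [OF assms(2)])
  from arg_cong [OF this, of "(*v) (resolvent A \<theta>)"] show ?thesis
    by (simp add: resolvent_left [OF assms(1)] matrix_vector_mult_diff_distrib
        matrix_vector_mult_scaleR algebra_simps)
qed

section \<open>Resolvent and Laplace transform of the claim law on the closed half line\<close>

locale me_law =
  fixes \<alpha> t :: "real^'p" and T :: "real^'p^'p"
  assumes min: "minimal_rep \<alpha> T t"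
    and density_nonneg: "\<And>x. 0 \<le> me_density \<alpha> T t x"
    and density_integrable: "integrable lborel (me_density \<alpha> T t)"
    and density_mass: "(\<integral>x. me_density \<alpha> T t x \<partial>lborel) = 1"
begin

lemma flow_abs_integrable: "(\<lambda>x. u \<bullet> flow T x v) absolutely_integrable_on {0..}"
  by (rule flow_integrable [OF min density_integrable])

lemma laplace_integrable:
  "\<theta> \<ge> 0 \<Longrightarrow> (\<lambda>x. exp (- \<theta> * x) * (u \<bullet> flow T x v)) absolutely_integrable_on {0..}"
  by (rule laplace_flow_integrable_mono [OF flow_abs_integrable])

lemma invertible: "\<theta> \<ge> 0 \<Longrightarrow> invertible (mat \<theta> - T)"
  by (rule laplace_flow_invertible [OF laplace_integrable])

lemma laplace_resolvent:
  "\<theta> \<ge> 0 \<Longrightarrow> ((\<lambda>x. exp (- \<theta> * x) * (u \<bullet> flow T x v)) has_integral (u \<bullet> (resolvent T \<theta> *v v))) {0..}"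
  by (rule laplace_flow [OF laplace_integrable])

definition lt :: "real \<Rightarrow> real" where
  "lt \<theta> = \<alpha> \<bullet> (resolvent T \<theta> *v t)"

lemma lt_density:
  assumes "\<theta> \<ge> 0"
  shows "integrable lborel (\<lambda>x. me_density \<alpha> T t x * exp (- \<theta> * x))" (is "integrable _ ?g")
    and "(\<integral>x. me_density \<alpha> T t x * exp (- \<theta> * x) \<partial>lborel) = lt \<theta>"
proof -
  have [measurable]: "me_density \<alpha> T t \<in> borel_measurable lborel"
    using density_integrable by (rule borel_measurable_integrable)
  have "norm (?g x) \<le> norm (me_density \<alpha> T t x)" for x
  proof (cases "x > 0")
    case True
    then have "exp (- \<theta> * x) \<le> 1"
      using assms by simp
    then show ?thesis
      using mult_left_mono [of "exp (- \<theta> * x)" 1 "\<bar>me_density \<alpha> T t x\<bar>"] by (simp add: abs_mult)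
  qed (simp add: me_density_def)
  then show int: "integrable lborel ?g"
    by (intro Bochner_Integration.integrable_bound [OF density_integrable]) simp_all
  have "((\<lambda>x. if x \<in> {0..} then exp (- \<theta> * x) * (\<alpha> \<bullet> flow T x t) else 0) has_integral lt \<theta>) UNIV"
    unfolding lt_def has_integral_restrict_UNIV by (rule laplace_resolvent [OF assms])
  \<comment> \<open>At x = 0 the density is 0 while the formula gives \<alpha> t, a discrepancy on a
    null set.\<close>
  then have "(?g has_integral lt \<theta>) UNIV"
    by (rule has_integral_spike [of "{0}", rotated -1]) (auto simp: me_density_def flow_def)
  then show "(\<integral>x. ?g x \<partial>lborel) = lt \<theta>"
    using has_integral_integral_lborel [OF int] has_integral_unique by blast
qed

lemma lt_0: "lt 0 = 1"
  using lt_density(2) [of 0] density_mass by simp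

lemma lt_nonneg: "\<theta> \<ge> 0 \<Longrightarrow> 0 \<le> lt \<theta>"
  unfolding lt_density(2) [symmetric] by (intro integral_nonneg_AE) (simp add: density_nonneg)

text \<open>The bound is uniform in \<theta>, which yields continuity of the resolvent without any
  estimate of a matrix inverse.\<close>

lemma resolvent_bounded:
  assumes "\<theta> \<ge> 0"
  shows "\<bar>u \<bullet> (resolvent T \<theta> *v v)\<bar> \<le> integral {0..} (\<lambda>x. \<bar>u \<bullet> flow T x v\<bar>)"
proof -
  have "norm (integral {0..} (\<lambda>x. exp (- \<theta> * x) * (u \<bullet> flow T x v))) \<le> integral {0..} (\<lambda>x. \<bar>u \<bullet> flow T x v\<bar>)"
  proof (rule integral_norm_bound_integral)
    show "(\<lambda>x. exp (- \<theta> * x) * (u \<bullet> flow T x v)) integrable_on {0..}"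
      using laplace_resolvent [OF assms] by blast
    show "(\<lambda>x. \<bar>u \<bullet> flow T x v\<bar>) integrable_on {0..}"
      using absolutely_integrable_norm [OF flow_abs_integrable] set_lebesgue_integral_eq_integral(1)
      by (fastforce simp: o_def)
    show "norm (exp (- \<theta> * x) * (u \<bullet> flow T x v)) \<le> \<bar>u \<bullet> flow T x v\<bar>" if "x \<in> {0..}" for x
      using that assms by (simp add: abs_mult mult_left_le_one_le)
  qed
  then show ?thesis
    using integral_unique [OF laplace_resolvent [OF assms]] by simp
qed

lemma resolvent_tendsto:
  assumes "\<theta> \<ge> 0"
  shows "((\<lambda>y. u \<bullet> (resolvent T y *v v)) \<longlongrightarrow> u \<bullet> (resolvent T \<theta> *v v)) (at \<theta> within {0..})"
proof (rule LIM_zero_cancel, rule Lim_null_comparison)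
  let ?B = "integral {0..} (\<lambda>x. \<bar>u \<bullet> flow T x (resolvent T \<theta> *v v)\<bar>)"
  have "norm (u \<bullet> (resolvent T y *v v) - u \<bullet> (resolvent T \<theta> *v v)) \<le> \<bar>\<theta> - y\<bar> * ?B" if "y \<ge> 0" for y
    using mult_left_mono [OF resolvent_bounded [OF that, of u "resolvent T \<theta> *v v"], of "\<bar>\<theta> - y\<bar>"]
      resolvent_identity [OF invertible [OF that] invertible [OF assms], of v]
    by (simp add: abs_mult flip: inner_diff_right)
  then show "eventually (\<lambda>y. norm (u \<bullet> (resolvent T y *v v) - u \<bullet> (resolvent T \<theta> *v v)) \<le> \<bar>\<theta> - y\<bar> * ?B) (at \<theta> within {0..})"
    by (simp add: eventually_at_filter)
  have "((\<lambda>y. \<bar>\<theta> - y\<bar> * ?B) \<longlongrightarrow> \<bar>\<theta> - \<theta>\<bar> * ?B) (at \<theta> within {0..})"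
    by (intro tendsto_intros)
  then show "((\<lambda>y. \<bar>\<theta> - y\<bar> * ?B) \<longlongrightarrow> 0) (at \<theta> within {0..})"
    by simp
qed

text \<open>By the resolvent identity the difference quotient is exactly - \<alpha> R(y) R(\<theta>)
  t, and continuity of the resolvent gives the limit. Working within the half line covers the right
  derivative at 0.\<close>

lemma lt_has_derivative:
  assumes "\<theta> \<ge> 0"
  shows "(lt has_field_derivative - (\<alpha> \<bullet> (resolvent T \<theta> *v (resolvent T \<theta> *v t)))) (at \<theta> within {0..})"
  unfolding has_field_derivative_iff
proof (rule Lim_transform_eventually)
  show "((\<lambda>y. - (\<alpha> \<bullet> (resolvent T y *v (resolvent T \<theta> *v t)))) \<longlongrightarrow>
      - (\<alpha> \<bullet> (resolvent T \<theta> *v (resolvent T \<theta> *v t)))) (at \<theta> within {0..})"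
    by (intro tendsto_minus resolvent_tendsto assms)
  have "- (\<alpha> \<bullet> (resolvent T y *v (resolvent T \<theta> *v t))) = (lt y - lt \<theta>) / (y - \<theta>)" if "y \<ge> 0" "y \<noteq> \<theta>" for y
  proof -
    have "lt y - lt \<theta> = (\<theta> - y) * (\<alpha> \<bullet> (resolvent T y *v (resolvent T \<theta> *v t)))"
      using resolvent_identity [OF invertible [OF that(1)] invertible [OF assms], of t]
      by (simp add: lt_def flip: inner_diff_right)
    then show ?thesis
      using that by (simp add: field_simps)
  qed
  then show "eventually (\<lambda>y. - (\<alpha> \<bullet> (resolvent T y *v (resolvent T \<theta> *v t))) = (lt y - lt \<theta>) / (y - \<theta>)) (at \<theta> within {0..})"
    by (simp add: eventually_at_filter)
qed

section \<open>The invariant cone and monotone convergence of the iterates\<close>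

definition pos :: "real^'p \<Rightarrow> bool" where
  "pos u \<longleftrightarrow> (\<forall>x>0. 0 \<le> u \<bullet> flow T x t)"

lemma pos_add: "pos u \<Longrightarrow> pos v \<Longrightarrow> pos (u + v)"
  by (simp add: pos_def inner_add_left)

lemma pos_scaleR: "c \<ge> 0 \<Longrightarrow> pos u \<Longrightarrow> pos (c *\<^sub>R u)"
  by (simp add: pos_def)

lemma pos_alpha: "pos \<alpha>"
  unfolding pos_def using density_nonneg by (metis flow_def me_density_def)

text \<open>The pairing with e^(T x) t is the integral over s of e^(-\<theta> s) u e^(T (s + x)) t,
  whose integrand is nonnegative.\<close>

lemma pos_resolvent:
  assumes "pos u" "\<theta> \<ge> 0"
  shows "pos (u v* resolvent T \<theta>)"
  unfolding pos_def
proof (intro allI impI)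
  fix x :: real
  assume "x > 0"
  then have "0 \<le> u \<bullet> flow T s (flow T x t)" if "s \<ge> 0" for s
    using that assms(1) by (simp add: pos_def flow_plus)
  then have "0 \<le> u \<bullet> (resolvent T \<theta> *v flow T x t)"
    using has_integral_nonneg [OF laplace_resolvent [OF assms(2), of u "flow T x t"]] by simp
  then show "0 \<le> (u v* resolvent T \<theta>) \<bullet> flow T x t"
    by (simp add: dot_lmul_matrix)
qed

lemma pos_inner_t:
  assumes "pos u"
  shows "0 \<le> u \<bullet> t"
proof (rule tendsto_lowerbound [OF inner_flow_tendsto_at_right_0 _ trivial_limit_at_right_real])
  show "eventually (\<lambda>s. 0 \<le> u \<bullet> flow T s t) (at_right 0)"
    using assms by (simp add: pos_def eventually_at_filter)
qed

text \<open>Multiplied out by \<theta> I - T and tested on vectors, the equation can be moved from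
  one shift \<theta> to another by scalar algebra.\<close>

lemma fixed_point_iff:
  assumes "\<theta> \<ge> 0"
  shows "L = u v* resolvent T \<theta> \<longleftrightarrow> (\<forall>v. L \<bullet> (\<theta> *\<^sub>R v - T *v v) = u \<bullet> v)"
proof
  assume "L = u v* resolvent T \<theta>"
  then show "\<forall>v. L \<bullet> (\<theta> *\<^sub>R v - T *v v) = u \<bullet> v"
    by (simp add: dot_lmul_matrix matrix_vector_mult_diff_distrib matrix_vector_mult_scaleR
        resolvent_left [OF invertible [OF assms]])
next
  assume *: "\<forall>v. L \<bullet> (\<theta> *\<^sub>R v - T *v v) = u \<bullet> v"
  have "L \<bullet> v = (u v* resolvent T \<theta>) \<bullet> v" for v
    using * [rule_format, of "resolvent T \<theta> *v v"]
    by (simp add: dot_lmul_matrix resolvent_right [OF invertible [OF assms]])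
  then show "L = u v* resolvent T \<theta>"
    using vector_eq_rdot by blast
qed

text \<open>Paired with a vector e^(T s) t the sequence is increasing and bounded. Such vectors
  span, so every pairing converges, in particular each coordinate.\<close>

lemma convergent_if_pos_bounded:
  fixes P :: "nat \<Rightarrow> real^'p"
  assumes inc: "\<And>n. pos (P (Suc n) - P n)" and bd: "\<And>n. pos (L - P n)"
  obtains L' where "P \<longlonglongrightarrow> L'"
proof -
  have conv: "convergent (\<lambda>n. P n \<bullet> v)" for v
  proof -
    have "v \<in> span {flow T s t | s. s > 0}"
      using span_flow [OF min] by simp
    then show ?thesis
    proof (induction rule: span_induct_alt)
      case base
      then show ?case by (simp add: convergent_const)
    next
      case (step r x y)
      then obtain s where s: "s > 0" "x = flow T s t"
        by blast
      have bound: "P n \<bullet> x \<le> L \<bullet> x" for n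
        using bd [of n] s by (simp add: pos_def inner_diff_left)
      have "P n \<bullet> x \<le> P (Suc n) \<bullet> x" for n
        using inc [of n] s by (simp add: pos_def inner_diff_left)
      then have "incseq (\<lambda>n. P n \<bullet> x)" and "\<forall>n. P n \<bullet> x \<le> L \<bullet> x"
        by (rule incseq_SucI) (use bound in simp)
      then obtain l where "(\<lambda>n. P n \<bullet> x) \<longlonglongrightarrow> l"
        by (rule incseq_convergent)
      then have "(\<lambda>n. r * (P n \<bullet> x) + P n \<bullet> y) \<longlonglongrightarrow> r * l + lim (\<lambda>n. P n \<bullet> y)"
        using step.IH [THEN convergent_LIMSEQ_iff [THEN iffD1]] by (rule tendsto_add [OF tendsto_mult_left])
      then have "convergent (\<lambda>n. r * (P n \<bullet> x) + P n \<bullet> y)"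
        by (rule convergentI)
      then show ?case
        by (simp add: inner_add_right)
    qed
  qed
  have "(\<lambda>n. P n $ i) \<longlonglongrightarrow> (\<chi> i. lim (\<lambda>n. P n $ i)) $ i" for i
    using conv [of "axis i 1", THEN convergent_LIMSEQ_iff [THEN iffD1]] by (simp add: inner_axis)
  then have "P \<longlonglongrightarrow> (\<chi> i. lim (\<lambda>n. P n $ i))"
    by (rule vec_tendstoI)
  then show ?thesis
    by (rule that)
qed

text \<open>For \<beta> = \<lambda> / d and c = (\<lambda> + q) / d the equation in
  \<open>root\<close> is \<psi>(\<gamma>) = q, divided by d and rearranged.\<close>

lemma riccati_iteration_tendsto:
  fixes P :: "nat \<Rightarrow> real^'p"
  assumes \<beta>: "\<beta> \<ge> 0" and c: "c \<ge> 0" and \<gamma>: "\<gamma> \<ge> 0" and root: "c - \<gamma> = \<beta> * lt \<gamma>"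
    and largest: "\<And>\<gamma>'. \<gamma>' \<ge> \<gamma> \<Longrightarrow> c - \<gamma>' = \<beta> * lt \<gamma>' \<Longrightarrow> \<gamma>' = \<gamma>"
    and P0: "P 0 = 0"
    and P: "\<And>n. P (Suc n) = (\<beta> *\<^sub>R \<alpha> + (P n \<bullet> t) *\<^sub>R P n) v* resolvent T c"
  shows "P \<longlonglongrightarrow> (\<beta> *\<^sub>R \<alpha>) v* resolvent T \<gamma>"
proof -
  define L where "L = (\<beta> *\<^sub>R \<alpha>) v* resolvent T \<gamma>"
  have Lt: "L \<bullet> t = c - \<gamma>"
    by (simp add: L_def dot_lmul_matrix root lt_def)
  have "\<forall>v. L \<bullet> (\<gamma> *\<^sub>R v - T *v v) = (\<beta> *\<^sub>R \<alpha>) \<bullet> v"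
    using fixed_point_iff [OF \<gamma>] L_def by blast
  \<comment> \<open>Because \<open>L \<bullet> t\<close> is c - \<gamma>, passing from shift
    \<gamma> to shift c adds exactly the quadratic term.\<close>
  then have "\<forall>v. L \<bullet> (c *\<^sub>R v - T *v v) = (\<beta> *\<^sub>R \<alpha> + (L \<bullet> t) *\<^sub>R L) \<bullet> v"
    by (simp add: Lt inner_add_left inner_diff_right algebra_simps)
  then have L: "L = (\<beta> *\<^sub>R \<alpha> + (L \<bullet> t) *\<^sub>R L) v* resolvent T c"
    using fixed_point_iff [OF c] by blast
  have pos_step: "pos ((\<beta> *\<^sub>R \<alpha> + (v \<bullet> t) *\<^sub>R v) v* resolvent T c - (\<beta> *\<^sub>R \<alpha> + (u \<bullet> t) *\<^sub>R u) v* resolvent T c)"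
    if "pos u" "pos (v - u)" for u v
  proof -
    have "pos v"
      using pos_add [OF that] by simp
    \<comment> \<open>This splits the difference of the quadratic terms (v t) v - (u t) u into two
      summands with nonnegative scalars and vectors in the cone.\<close>
    have "pos (((v - u) \<bullet> t) *\<^sub>R u + (v \<bullet> t) *\<^sub>R (v - u))"
      using that \<open>pos v\<close> by (intro pos_add pos_scaleR pos_inner_t)
    then have "pos ((((v - u) \<bullet> t) *\<^sub>R u + (v \<bullet> t) *\<^sub>R (v - u)) v* resolvent T c)"
      using c by (rule pos_resolvent)
    then show ?thesis
      by (simp add: inner_diff_left algebra_simps flip: vector_matrix_mult_diff_distrib)
  qed
  have posP: "pos (P n)" for n
  proof (induction n)
    case (Suc n)
    then show ?case
      unfolding P by (intro pos_resolvent pos_add pos_scaleR pos_alpha pos_inner_t \<beta> c)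
  qed (simp add: P0 pos_def)
  have inc: "pos (P (Suc n) - P n)" for n
  proof (induction n)
    case 0
    show ?case
      using posP [of "Suc 0"] by (simp add: P0)
  next
    case (Suc n)
    show ?case
      using pos_step [OF posP Suc] by (simp only: P [symmetric])
  qed
  have bd: "pos (L - P n)" for n
  proof (induction n)
    case 0
    have "pos L"
      unfolding L_def using \<beta> \<gamma> by (intro pos_resolvent pos_scaleR pos_alpha)
    then show ?case
      by (simp add: P0)
  next
    case (Suc n)
    show ?case
      using pos_step [OF posP Suc] by (simp only: P [symmetric] L [symmetric])
  qed
  obtain L' where L': "P \<longlonglongrightarrow> L'"
    by (rule convergent_if_pos_bounded [of P L]) (use inc bd in auto)
  have "(\<lambda>n. P (Suc n)) \<longlonglongrightarrow> (\<beta> *\<^sub>R \<alpha> + (L' \<bullet> t) *\<^sub>R L') v* resolvent T c"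
    unfolding P transpose_matrix_vector [symmetric]
    by (intro bounded_linear.tendsto [OF matrix_vector_mul_bounded_linear] tendsto_intros L')
  then have fixed: "L' = (\<beta> *\<^sub>R \<alpha> + (L' \<bullet> t) *\<^sub>R L') v* resolvent T c"
    using L' LIMSEQ_Suc LIMSEQ_unique by blast
  define \<gamma>' where "\<gamma>' = c - L' \<bullet> t"
  \<comment> \<open>The comparison with \<open>L\<close> gives \<gamma>' \<ge> \<gamma>: this makes
    the resolvent at \<gamma>' available and lets \<open>largest\<close> apply.\<close>
  have "L' \<bullet> t \<le> L \<bullet> t"
  proof (rule LIMSEQ_le_const2)
    show "(\<lambda>n. P n \<bullet> t) \<longlonglongrightarrow> L' \<bullet> t"
      by (intro tendsto_intros L')
    show "\<exists>N. \<forall>n\<ge>N. P n \<bullet> t \<le> L \<bullet> t"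
      using pos_inner_t [OF bd] by (auto simp: inner_diff_left)
  qed
  then have ge: "\<gamma>' \<ge> \<gamma>"
    by (simp add: \<gamma>'_def Lt)
  have "\<forall>v. L' \<bullet> (c *\<^sub>R v - T *v v) = (\<beta> *\<^sub>R \<alpha> + (L' \<bullet> t) *\<^sub>R L') \<bullet> v"
    using fixed_point_iff [OF c] fixed by blast
  then have "\<forall>v. L' \<bullet> (\<gamma>' *\<^sub>R v - T *v v) = (\<beta> *\<^sub>R \<alpha>) \<bullet> v"
    by (simp add: \<gamma>'_def inner_add_left inner_diff_right algebra_simps)
  then have L'_eq: "L' = (\<beta> *\<^sub>R \<alpha>) v* resolvent T \<gamma>'"
    using fixed_point_iff [of \<gamma>'] ge \<gamma> by auto
  then have "L' \<bullet> t = \<beta> * lt \<gamma>'"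
    by (simp add: dot_lmul_matrix lt_def)
  then have "\<gamma>' = \<gamma>"
    using ge by (intro largest) (simp_all add: \<gamma>'_def)
  then show ?thesis
    using L' L'_eq by simp
qed

end

section \<open>Uniqueness of Laplace transforms\<close>

text \<open>By Weierstrass, \<open>\<integral> \<phi> (exp (- x)) * h x = 0\<close> for every continuous \<open>\<phi>\<close> on \<open>[0, 1]\<close>. The choice
  \<open>\<phi> (exp (- x)) = exp (- x) * h x / (1 + \<bar>h x\<bar>)\<close> makes the integrand nonnegative; the factor
  \<open>exp (- x)\<close> gives continuity of \<open>\<phi>\<close> at \<open>0\<close>.\<close>

lemma zero_if_exp_moments_zero:
  fixes h :: "real \<Rightarrow> real"
  assumes cont: "continuous_on {0..} h" and int: "h absolutely_integrable_on {0..}"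
    and moments: "\<And>n. ((\<lambda>x. exp (- x) ^ n * h x) has_integral 0) {0..}"
    and "x \<ge> 0"
  shows "h x = 0"
proof -
  define g :: "real \<Rightarrow> real" where "g z = z / (1 + \<bar>z\<bar>)" for z
  have g_le: "\<bar>g z\<bar> \<le> 1" for z
    by (simp add: g_def divide_simps)
  have g_cont: "continuous_on S (\<lambda>x. g (f x))" if "continuous_on S f" for S :: "real set" and f
    unfolding g_def using that by (intro continuous_intros) (auto simp: add_nonneg_eq_0_iff)
  define \<phi> where "\<phi> y = y * g (h (- ln y))" for y
  have \<phi>_cont: "continuous_on {0..1} \<phi>"
    unfolding continuous_on_def
  proof
    fix y :: real
    assume y: "y \<in> {0..1}"
    show "(\<phi> \<longlongrightarrow> \<phi> y) (at y within {0..1})"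
    proof (cases "y = 0")
      case True
      have "norm (\<phi> z) \<le> \<bar>z\<bar>" for z
        using mult_left_mono [OF g_le, of "\<bar>z\<bar>"] by (simp add: \<phi>_def abs_mult)
      moreover have "((\<lambda>z. \<bar>z\<bar>) \<longlongrightarrow> 0) (at 0 within {0..1 :: real})"
        by (rule tendsto_eq_intros refl | simp)+
      ultimately have "(\<phi> \<longlongrightarrow> 0) (at 0 within {0..1})"
        by (intro Lim_null_comparison [of \<phi> "\<lambda>z. \<bar>z\<bar>"]) simp_all
      then show ?thesis
        using True by (simp add: \<phi>_def)
    next
      case False
      have "continuous_on {0<..1} (\<lambda>y. h (- ln y))"
        by (rule continuous_on_compose2 [OF cont]) (auto intro!: continuous_intros)
      then have "continuous_on {0<..1} \<phi>"
        unfolding \<phi>_def by (intro continuous_on_mult continuous_on_id g_cont)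
      then have "(\<phi> \<longlongrightarrow> \<phi> y) (at y within {0<..1})"
        using y False by (auto simp: continuous_on_def)
      moreover have "at y within {0..1} = at y within {0<..1}"
        using y False by (intro at_within_nhd [of y "{0<..}"]) auto
      ultimately show ?thesis
        by simp
    qed
  qed
  define k where "k x = \<phi> (exp (- x)) * h x" for x
  have k_eq: "k x = exp (- x) * (h x ^ 2 / (1 + \<bar>h x\<bar>))" for x
    by (simp add: k_def \<phi>_def g_def power2_eq_square)
  have k_nonneg: "0 \<le> k x" for x
    by (simp add: k_eq)
  have k_cont: "continuous_on {0..} k"
    unfolding k_eq using cont by (intro continuous_intros) (auto simp: add_nonneg_eq_0_iff)
  have abs_h: "(\<lambda>x. \<bar>h x\<bar>) integrable_on {0..}"
    using set_lebesgue_integral_eq_integral(1) [OF absolutely_integrable_norm [OF int]]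
    by (simp add: o_def)
  have k_int: "k integrable_on {0..}"
  proof -
    have "k absolutely_integrable_on {0..}"
    proof (rule measurable_bounded_by_integrable_imp_absolutely_integrable [OF _ _ abs_h])
      show "k \<in> borel_measurable (lebesgue_on {0..})"
        by (intro continuous_imp_measurable_on_sets_lebesgue k_cont) simp
      show "norm (k x) \<le> \<bar>h x\<bar>" if "x \<in> {0..}" for x
        using that mult_mono [of "exp (- x)" 1 "\<bar>g (h x)\<bar>" 1] g_le [of "h x"]
        by (simp add: k_def \<phi>_def abs_mult mult_left_le_one_le)
    qed auto
    then show ?thesis
      by (rule set_lebesgue_integral_eq_integral(1))
  qed
  have small: "\<bar>integral {0..} k\<bar> \<le> e * integral {0..} (\<lambda>x. \<bar>h x\<bar>)" if "e > 0" for e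
  proof -
    obtain p where p: "real_polynomial_function p" "\<And>y. y \<in> {0..1} \<Longrightarrow> \<bar>\<phi> y - p y\<bar> < e"
      using Stone_Weierstrass_real_polynomial_function [OF _ \<phi>_cont \<open>e > 0\<close>] by auto
    then obtain a n where a: "p = (\<lambda>y. \<Sum>i\<le>n. a i * y ^ i)"
      unfolding real_polynomial_function_iff_sum by blast
    have "((\<lambda>x. \<Sum>i\<le>n. a i * (exp (- x) ^ i * h x)) has_integral (\<Sum>i\<le>n. a i * 0)) {0..}"
      by (intro has_integral_sum has_integral_mult_right moments) simp
    then have "((\<lambda>x. p (exp (- x)) * h x) has_integral 0) {0..}"
      by (simp add: a sum_distrib_right mult.assoc)
    then have diff: "((\<lambda>x. k x - p (exp (- x)) * h x) has_integral (integral {0..} k - 0)) {0..}"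
      using k_int by (intro has_integral_diff integrable_integral)
    then have "norm (integral {0..} (\<lambda>x. k x - p (exp (- x)) * h x)) \<le> integral {0..} (\<lambda>x. e * \<bar>h x\<bar>)"
    proof (intro integral_norm_bound_integral)
      show "(\<lambda>x. e * \<bar>h x\<bar>) integrable_on {0..}"
        using abs_h by (rule integrable_on_mult_right)
      show "norm (k x - p (exp (- x)) * h x) \<le> e * \<bar>h x\<bar>" if "x \<in> {0..}" for x
        using p(2) [of "exp (- x)"] that
        by (simp add: k_def abs_mult mult_right_mono flip: left_diff_distrib)
    qed blast
    then show ?thesis
      using integral_unique [OF diff] by simp
  qed
  have "\<bar>integral {0..} k\<bar> \<le> 0"
  proof (rule ccontr)
    assume neg: "\<not> \<bar>integral {0..} k\<bar> \<le> 0"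
    let ?B = "integral {0..} (\<lambda>x. \<bar>h x\<bar>)"
    have "0 \<le> ?B"
      using abs_h by (rule integral_nonneg) simp
    \<comment> \<open>The tolerance is the modulus of the integral over 2 (B + 1); the added 1
      covers B = 0.\<close>
    then have "2 * \<bar>integral {0..} k\<bar> + \<bar>integral {0..} k\<bar> * ?B \<le> 0"
      using small [of "\<bar>integral {0..} k\<bar> / (2 * (?B + 1))"] neg by (simp add: field_simps)
    moreover have "0 \<le> \<bar>integral {0..} k\<bar> * ?B"
      using \<open>0 \<le> ?B\<close> by simp
    ultimately show False
      using neg by linarith
  qed
  then have k0: "integral {0..} k = 0"
    by simp
  \<comment> \<open>The right end x + 1 keeps the interval nondegenerate even for x = 0.\<close>
  have "k integrable_on {0..x + 1}"
    using k_cont by (intro integrable_continuous_real) (auto intro: continuous_on_subset)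
  moreover have "integral {0..x + 1} k \<le> integral {0..} k"
    using calculation k_int k_nonneg by (intro integral_subset_le) auto
  ultimately have "integral {0..x + 1} k = 0"
    using k0 integral_nonneg [of k "{0..x + 1}"] k_nonneg by fastforce
  moreover have "continuous_on {0..x + 1} k"
    using k_cont by (rule continuous_on_subset) auto
  ultimately have "k x = 0"
    using integral_eq_0_iff [of 0 "x + 1" k] k_nonneg \<open>x \<ge> 0\<close> by auto
  then show "h x = 0"
    by (auto simp: k_eq add_nonneg_eq_0_iff)
qed

text \<open>The transforms at \<theta> + n are the moments of e^(-\<theta> x) (f - g) against the
  powers of e^(-x), so all of these moments vanish.\<close>

lemma laplace_transform_unique:
  fixes f g :: "real \<Rightarrow> real"
  assumes cont: "continuous_on {0..} f" "continuous_on {0..} g"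
    and int: "(\<lambda>x. exp (- \<theta> * x) * f x) absolutely_integrable_on {0..}"
      "(\<lambda>x. exp (- \<theta> * x) * g x) absolutely_integrable_on {0..}"
    and lap: "\<And>\<eta>. \<eta> \<ge> \<theta> \<Longrightarrow> ((\<lambda>x. exp (- \<eta> * x) * f x) has_integral I \<eta>) {0..}"
      "\<And>\<eta>. \<eta> \<ge> \<theta> \<Longrightarrow> ((\<lambda>x. exp (- \<eta> * x) * g x) has_integral I \<eta>) {0..}"
    and "x \<ge> 0"
  shows "f x = g x"
proof -
  let ?h = "\<lambda>x. exp (- \<theta> * x) * f x - exp (- \<theta> * x) * g x"
  have "?h x = 0"
  proof (rule zero_if_exp_moments_zero [OF _ _ _ \<open>x \<ge> 0\<close>])
    show "continuous_on {0..} ?h"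
      by (intro continuous_intros cont)
    show "?h absolutely_integrable_on {0..}"
      by (rule set_integral_diff(1) [OF int])
    show "((\<lambda>x. exp (- x) ^ n * ?h x) has_integral 0) {0..}" for n
    proof -
      have "exp (- x) ^ n * ?h x = exp (- (\<theta> + real n) * x) * f x - exp (- (\<theta> + real n) * x) * g x" for x
        by (simp add: exp_of_nat_mult [symmetric] algebra_simps flip: exp_add)
      then show ?thesis
        using has_integral_diff [OF lap(1) [of "\<theta> + real n"] lap(2) [of "\<theta> + real n"]] by simp
    qed
  qed
  then show ?thesis
    by simp
qed

section \<open>The exponent of a compound Poisson process\<close>

text \<open>This converts the independence of sigma-algebras in \<open>indep_count_claims\<close>
  into independence of real variables computed from the count and from the claims.\<close>

lemma (in prob_space) indep_set_imp_indep_var: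
  assumes ind: "indep_set (sets A) (sets B)" and space: "space A = space M" "space B = space M"
    and X: "X \<in> measurable A S" and Y: "Y \<in> measurable B S'"
    and XM: "random_variable S X" and YM: "random_variable S' Y"
  shows "indep_var S X S' Y"
proof -
  have "sigma_sets (space M) {X -` E \<inter> space M | E. E \<in> sets S} \<subseteq> sets A"
    unfolding space(1) [symmetric]
    by (intro sets.sigma_sets_subset) (use measurable_sets [OF X] in auto)
  moreover have "sigma_sets (space M) {Y -` E \<inter> space M | E. E \<in> sets S'} \<subseteq> sets B"
    unfolding space(2) [symmetric]
    by (intro sets.sigma_sets_subset) (use measurable_sets [OF Y] in auto)
  ultimately have "indep_set (sigma_sets (space M) {X -` E \<inter> space M | E. E \<in> sets S})
      (sigma_sets (space M) {Y -` E \<inter> space M | E. E \<in> sets S'})"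
    using ind unfolding indep_set_def
    by (rule_tac indep_sets_mono_sets) (auto split: bool.splits)
  then show ?thesis
    unfolding indep_var_eq using XM YM by blast
qed

lemma (in poisson_process) prob_count_1:
  "prob {\<omega> \<in> space M. N 1 \<omega> = n} = lam ^ n / fact n * exp (- lam)"
proof -
  have [measurable]: "N 0 \<in> M \<rightarrow>\<^sub>M count_space UNIV" "N 1 \<in> M \<rightarrow>\<^sub>M count_space UNIV"
    using measurable_count by simp_all
  \<comment> \<open>The process starts at 0 only almost surely, so the count is exchanged for an
    increment up to a null set.\<close>
  have "prob {\<omega> \<in> space M. N 1 \<omega> = n} = prob ((\<lambda>\<omega>. N 1 \<omega> - N 0 \<omega>) -` {n} \<inter> space M)"
    using start_zero by (intro finite_measure_eq_AE) auto
  also have "\<dots> = measure (distr M (count_space UNIV) (\<lambda>\<omega>. N 1 \<omega> - N 0 \<omega>)) {n}"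
    by (subst measure_distr) simp_all
  also have "\<dots> = pmf (poisson_pmf lam) n"
    using poisson_increments [of 0 1] by (simp add: measure_pmf_single)
  finally show ?thesis
    using rate_pos by simp
qed

text \<open>Splitting over the value n of the count at time 1, independence turns each term into the
  Poisson weight of n times m^n, and the exponential series sums these.\<close>

lemma (in poisson_process) compound_poisson_mgf:
  fixes C :: "nat \<Rightarrow> 'a \<Rightarrow> real"
  assumes C: "indep_vars (\<lambda>_. borel) C {1..}" and NC: "indep_count_claims M N C"
    and int: "\<And>j. 1 \<le> j \<Longrightarrow> integrable M (\<lambda>\<omega>. exp (- \<theta> * C j \<omega>))"
    and mgf: "\<And>j. 1 \<le> j \<Longrightarrow> expectation (\<lambda>\<omega>. exp (- \<theta> * C j \<omega>)) = m"
  shows "expectation (\<lambda>\<omega>. exp (\<theta> * risk_process d N C 1 \<omega>)) = exp (d * \<theta> + lam * (m - 1))"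
proof -
  let ?A = "vimage_algebra (space M) (\<lambda>\<omega>. \<lambda>s\<in>{0..}. N s \<omega>) (PiM {0..} (\<lambda>_. count_space UNIV))"
  let ?B = "vimage_algebra (space M) (\<lambda>\<omega>. \<lambda>j\<in>{1..}. C j \<omega>) (PiM {1..} (\<lambda>_. borel))"
  define Ind where "Ind n \<omega> = (if n = N 1 \<omega> then 1 else 0 :: real)" for n \<omega>
  define Y where "Y n \<omega> = (\<Prod>j=1..n. exp (- \<theta> * C j \<omega>))" for n \<omega>
  have [measurable]: "N 1 \<in> M \<rightarrow>\<^sub>M count_space UNIV"
    using measurable_count by simp
  have C_meas [measurable]: "C j \<in> borel_measurable M" if "1 \<le> j" for j
    using C that by (auto simp: indep_vars_def)
  have Ind_meas [measurable]: "Ind n \<in> borel_measurable M" for n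
    unfolding Ind_def by measurable
  have Y_meas [measurable]: "Y n \<in> borel_measurable M" for n
    unfolding Y_def by (intro borel_measurable_prod) (auto intro!: borel_measurable_exp borel_measurable_times)
  have Y_indep: "indep_vars (\<lambda>_. borel) (\<lambda>j \<omega>. exp (- \<theta> * C j \<omega>)) {1..n}" for n
    by (rule indep_vars_compose2 [OF indep_vars_subset [OF C]]) auto
  have Y_int: "integrable M (Y n)" for n
    unfolding Y_def by (rule indep_vars_integrable [OF _ Y_indep]) (use int in simp_all)
  have Y_exp: "expectation (Y n) = m ^ n" for n
    unfolding Y_def by (subst indep_vars_lebesgue_integral [OF _ Y_indep]) (use int mgf in simp_all)
  have Ind_int: "integrable M (Ind n)" for n
    by (rule integrable_const_bound [of _ 1]) (simp_all add: Ind_def)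
  have Ind_exp: "expectation (Ind n) = lam ^ n / fact n * exp (- lam)" for n
  proof -
    have "expectation (Ind n) = expectation (indicat_real {\<omega> \<in> space M. N 1 \<omega> = n})"
      by (intro Bochner_Integration.integral_cong) (auto simp: Ind_def)
    then show ?thesis
      by (simp add: prob_count_1)
  qed
  have indep: "indep_var borel (Ind n) borel (Y n)" for n
  proof (rule indep_set_imp_indep_var [OF NC [unfolded indep_count_claims_def]])
    have "(\<lambda>\<omega>. \<lambda>s\<in>{0..}. N s \<omega>) \<in> ?A \<rightarrow>\<^sub>M PiM {0..} (\<lambda>_. count_space UNIV)"
      by (intro measurable_vimage_algebra1) (auto simp: space_PiM)
    from measurable_compose [OF this measurable_component_singleton [of 1]]
    have [measurable]: "N 1 \<in> ?A \<rightarrow>\<^sub>M count_space UNIV"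
      by simp
    show "Ind n \<in> borel_measurable ?A"
      unfolding Ind_def by measurable
    have "(\<lambda>\<omega>. \<lambda>j\<in>{1..}. C j \<omega>) \<in> ?B \<rightarrow>\<^sub>M PiM {1..} (\<lambda>_. borel)"
      by (intro measurable_vimage_algebra1) (auto simp: space_PiM)
    from measurable_compose [OF this measurable_component_singleton]
    have "C j \<in> borel_measurable ?B" if "1 \<le> j" for j
      using that by simp
    then show "Y n \<in> borel_measurable ?B"
      unfolding Y_def by (intro borel_measurable_prod) (auto intro!: borel_measurable_exp borel_measurable_times)
  qed simp_all
  have prod_int: "integrable M (\<lambda>\<omega>. Ind n \<omega> * Y n \<omega>)" for n
    by (rule indep_var_integrable [OF indep Ind_int Y_int])
  have prod_exp: "expectation (\<lambda>\<omega>. Ind n \<omega> * Y n \<omega>) = exp (- lam) * ((lam * m) ^ n /\<^sub>R fact n)" for n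
    using indep_var_lebesgue_integral [OF indep Ind_int Y_int]
    by (simp add: Ind_exp Y_exp power_mult_distrib field_simps)
  have sums: "(\<lambda>n. Ind n \<omega> * Y n \<omega>) sums Y (N 1 \<omega>) \<omega>" for \<omega>
    using sums_single [of "N 1 \<omega>" "\<lambda>n. Y n \<omega>"] by (simp add: Ind_def if_distrib if_distribR cong: if_cong)
  have exp_sums: "(\<lambda>n. exp (- lam) * ((lam * m) ^ n /\<^sub>R fact n)) sums (exp (- lam) * exp (lam * m))"
    by (intro sums_mult exp_converges)
  have "expectation (\<lambda>\<omega>. \<Sum>n. Ind n \<omega> * Y n \<omega>) = (\<Sum>n. expectation (\<lambda>\<omega>. Ind n \<omega> * Y n \<omega>))"
  proof (rule integral_suminf [OF prod_int])
    \<comment> \<open>All terms are nonnegative, so the absolute summability needed to exchange sum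
      and expectation is that of the same exponential series.\<close>
    have nonneg: "norm (Ind n \<omega> * Y n \<omega>) = Ind n \<omega> * Y n \<omega>" for n \<omega>
      by (simp add: Ind_def Y_def prod_nonneg)
    show "AE \<omega> in M. summable (\<lambda>n. norm (Ind n \<omega> * Y n \<omega>))"
      unfolding nonneg using sums by (auto simp: sums_iff)
    show "summable (\<lambda>n. expectation (\<lambda>\<omega>. norm (Ind n \<omega> * Y n \<omega>)))"
      unfolding nonneg prod_exp using exp_sums by (auto simp: sums_iff)
  qed
  then have "expectation (\<lambda>\<omega>. Y (N 1 \<omega>) \<omega>) = exp (- lam) * exp (lam * m)"
    using sums exp_sums by (simp add: sums_iff prod_exp)
  moreover have "exp (\<theta> * risk_process d N C 1 \<omega>) = exp (d * \<theta>) * Y (N 1 \<omega>) \<omega>" for \<omega>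
    by (simp add: risk_process_def Y_def sum_distrib_left right_diff_distrib mult.commute
        flip: exp_add exp_sum sum_negf)
  ultimately show ?thesis
    by (simp add: algebra_simps flip: exp_add)
qed

section \<open>The scale function\<close>

lemma outer_prod_vector_mult: "outer_prod u v *v x = (v \<bullet> x) *\<^sub>R u"
  by (simp add: vec_eq_iff outer_prod_def matrix_vector_mult_def inner_vec_def sum_distrib_left
      mult_ac)

text \<open>This makes the derivative relative to the half line unique, also at its endpoint, as
  \<open>exponent_deriv\<close> requires.\<close>

lemma at_within_atLeast_neq_bot:
  fixes x :: real
  assumes "x \<ge> a"
  shows "at x within {a..} \<noteq> bot"
proof
  assume "at x within {a..} = bot"
  moreover have "at x within {x..} \<le> at x within {a..}"
    using assms by (intro at_le) auto
  ultimately have "at_right x = bot"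
    by (simp add: at_within_Ici_at_right bot_unique)
  then show False
    by simp
qed

text \<open>Integrability and total mass one come from transferring the constant function 1 from the
  probability space to the density.\<close>

lemma me_law_matrix_exponential_rv:
  assumes "prob_space M" and "minimal_rep \<alpha> T t" and rv: "matrix_exponential_rv M Y \<alpha> T t"
  shows "me_law \<alpha> t T"
proof -
  interpret prob_space M by fact
  have D: "distributed M lborel Y (\<lambda>x. ennreal (me_density \<alpha> T t x))"
    and nonneg: "\<And>x. 0 \<le> me_density \<alpha> T t x"
    using rv by (simp_all add: matrix_exponential_rv_def)
  show ?thesis
    by standard
      (use assms(2) nonneg distributed_integrable [OF D, of "\<lambda>_. 1"] distributed_integral [OF D, of "\<lambda>_. 1"]
        in \<open>simp_all add: prob_space\<close>)
qed

context me_law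
begin

lemma matrix_exponential_rv_mgf:
  assumes "matrix_exponential_rv M Y \<alpha> T t" and "\<theta> \<ge> 0"
  shows "integrable M (\<lambda>\<omega>. exp (- \<theta> * Y \<omega>))" and "(\<integral>\<omega>. exp (- \<theta> * Y \<omega>) \<partial>M) = lt \<theta>"
proof -
  have D: "distributed M lborel Y (\<lambda>x. ennreal (me_density \<alpha> T t x))"
    using assms by (simp add: matrix_exponential_rv_def)
  show "integrable M (\<lambda>\<omega>. exp (- \<theta> * Y \<omega>))"
    using distributed_integrable [OF D, of "\<lambda>x. exp (- \<theta> * x)"] lt_density(1) [OF assms(2)] density_nonneg
    by simp
  show "(\<integral>\<omega>. exp (- \<theta> * Y \<omega>) \<partial>M) = lt \<theta>"
    using distributed_integral [OF D, of "\<lambda>x. exp (- \<theta> * x)"] lt_density(2) [OF assms(2)] density_nonneg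
    by simp
qed

lemma lt_continuous_on: "continuous_on {0..} lt"
  by (rule DERIV_continuous_on) (rule lt_has_derivative, simp)

end

section \<open>Largest root, Riccati equation and perturbed resolvent\<close>

locale me_exponent = me_law +
  fixes d lam :: real and \<psi> :: "real \<Rightarrow> real"
  assumes d_pos: "d > 0" and lam_pos: "lam > 0"
    and \<psi>_eq: "\<And>\<theta>. \<theta> \<ge> 0 \<Longrightarrow> \<psi> \<theta> = d * \<theta> + lam * (lt \<theta> - 1)"
begin

text \<open>\<open>GREATEST\<close> is meaningful only once a maximum exists. Since
  \<open>lt\<close> is nonnegative, \<psi>(B) \<ge> q and no root exceeds B; the intermediate value
  theorem gives a root and compactness a largest one.\<close>

lemma largest_root_greatest:
  assumes "q \<ge> 0"
  shows "largest_root \<psi> q \<ge> 0" and "\<psi> (largest_root \<psi> q) = q"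
    and "\<And>\<theta>. \<theta> \<ge> 0 \<Longrightarrow> \<psi> \<theta> = q \<Longrightarrow> \<theta> \<le> largest_root \<psi> q"
proof -
  define B where "B = (q + lam) / d"
  have B: "B \<ge> 0"
    using assms d_pos lam_pos by (simp add: B_def)
  have cont: "continuous_on {0..B} \<psi>"
  proof -
    have "continuous_on {0..B} (\<lambda>\<theta>. d * \<theta> + lam * (lt \<theta> - 1))"
      by (intro continuous_intros continuous_on_subset [OF lt_continuous_on]) auto
    then show ?thesis
      by (subst continuous_on_cong [OF refl \<psi>_eq]) auto
  qed
  let ?S = "{\<theta> \<in> {0..B}. \<psi> \<theta> = q}"
  have lower: "\<psi> 0 \<le> q"
    using assms by (simp add: \<psi>_eq lt_0)
  have upper: "q \<le> \<psi> B"
    using mult_nonneg_nonneg [OF less_imp_le [OF lam_pos] lt_nonneg [OF B]] B d_pos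
    by (simp add: \<psi>_eq B_def algebra_simps)
  have nonempty: "?S \<noteq> {}"
    using IVT' [OF lower upper B cont] by auto
  have "closed ?S"
    by (rule continuous_closed_preimage_constant [OF cont closed_atLeastAtMost])
  moreover have "bounded ?S"
    by (rule bounded_subset [OF bounded_closed_interval]) auto
  ultimately have "compact ?S"
    by (simp add: compact_eq_bounded_closed)
  then obtain m where m: "m \<in> ?S" "\<And>\<theta>. \<theta> \<in> ?S \<Longrightarrow> \<theta> \<le> m"
    using compact_attains_sup [OF _ nonempty] by blast
  have le: "\<theta> \<le> m" if "\<theta> \<ge> 0" "\<psi> \<theta> = q" for \<theta>
  proof -
    have "0 \<le> lam * lt \<theta>"
      using lam_pos lt_nonneg that by simp
    then have "\<theta> \<le> B"
      using that d_pos by (simp add: \<psi>_eq B_def field_simps)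
    then show ?thesis
      using that by (intro m) simp
  qed
  have "largest_root \<psi> q = m"
    unfolding largest_root_def by (intro Greatest_equality) (use m le in auto)
  then show "largest_root \<psi> q \<ge> 0" "\<psi> (largest_root \<psi> q) = q"
    "\<And>\<theta>. \<theta> \<ge> 0 \<Longrightarrow> \<psi> \<theta> = q \<Longrightarrow> \<theta> \<le> largest_root \<psi> q"
    using m le by auto
qed

lemma exponent_deriv_eq:
  assumes "\<theta> \<ge> 0"
  shows "exponent_deriv \<psi> \<theta> = d - lam * (\<alpha> \<bullet> (resolvent T \<theta> *v (resolvent T \<theta> *v t)))"
proof -
  have "((\<lambda>\<theta>. d * \<theta> + lam * (lt \<theta> - 1)) has_field_derivative
      d - lam * (\<alpha> \<bullet> (resolvent T \<theta> *v (resolvent T \<theta> *v t)))) (at \<theta> within {0..})"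
    by (auto intro!: derivative_eq_intros lt_has_derivative [OF assms])
  then have "(\<psi> has_field_derivative
      d - lam * (\<alpha> \<bullet> (resolvent T \<theta> *v (resolvent T \<theta> *v t)))) (at \<theta> within {0..})"
    by (rule has_field_derivative_transform_within [of _ _ _ _ 1]) (use assms \<psi>_eq in auto)
  then show ?thesis
    unfolding exponent_deriv_def has_real_derivative_iff_has_vector_derivative
    by (rule vector_derivative_within [OF at_within_atLeast_neq_bot [OF assms]])
qed

lemma solution_inner_t:
  assumes "\<Phi> \<ge> 0" and "\<psi> \<Phi> = q" and L: "L = ((lam / d) *\<^sub>R \<alpha>) v* resolvent T \<Phi>"
  shows "L \<bullet> t = (lam + q) / d - \<Phi>"
proof -
  have "L \<bullet> t = lam / d * lt \<Phi>"
    by (simp add: L dot_lmul_matrix lt_def)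
  moreover have "d * \<Phi> + lam * (lt \<Phi> - 1) = q"
    using assms(2) \<psi>_eq [OF assms(1)] by simp
  ultimately show ?thesis
    using d_pos by (simp add: field_simps)
qed

text \<open>Tested on v, the outer product contributes (L v)(L t), and the value of L t from
  \<open>solution_inner_t\<close> turns the equation back into the linear one with shift
  \<Phi>.\<close>

lemma riccati_solution:
  assumes "\<Phi> \<ge> 0" and "\<psi> \<Phi> = q" and L: "L = ((lam / d) *\<^sub>R \<alpha>) v* resolvent T \<Phi>"
  shows "L v* (mat (lam + q) - d *\<^sub>R T - d *\<^sub>R outer_prod t L) = lam *\<^sub>R \<alpha>"
proof (rule vector_eq_rdot [THEN iffD1], rule allI)
  fix v
  have "L \<bullet> (\<Phi> *\<^sub>R v - T *v v) = ((lam / d) *\<^sub>R \<alpha>) \<bullet> v"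
    using fixed_point_iff [OF assms(1), THEN iffD1, OF L] by simp
  then have eq: "d * (\<Phi> * (L \<bullet> v) - L \<bullet> (T *v v)) = lam * (\<alpha> \<bullet> v)"
    using d_pos by (simp add: inner_diff_right)
  have "(L v* (mat (lam + q) - d *\<^sub>R T - d *\<^sub>R outer_prod t L)) \<bullet> v =
      (lam + q) * (L \<bullet> v) - d * (L \<bullet> (T *v v)) - d * ((L \<bullet> v) * (L \<bullet> t))"
    by (simp only: dot_lmul_matrix matrix_vector_mult_diff_rdistrib mat_vector_mult inner_diff_right
        outer_prod_vector_mult scaleR_matrix_vector_assoc [symmetric] inner_scaleR_right)
  also have "\<dots> = (lam + q) * (L \<bullet> v) - d * (L \<bullet> (T *v v)) - (L \<bullet> v) * (d * ((lam + q) / d - \<Phi>))"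
    unfolding solution_inner_t [OF assms] by simp
  also have "d * ((lam + q) / d - \<Phi>) = lam + q - d * \<Phi>"
    using d_pos by (simp add: right_diff_distrib)
  also have "(lam + q) * (L \<bullet> v) - d * (L \<bullet> (T *v v)) - (L \<bullet> v) * (lam + q - d * \<Phi>) =
      d * (\<Phi> * (L \<bullet> v) - L \<bullet> (T *v v))"
    by (simp add: algebra_simps)
  finally show "(L v* (mat (lam + q) - d *\<^sub>R T - d *\<^sub>R outer_prod t L)) \<bullet> v = (lam *\<^sub>R \<alpha>) \<bullet> v"
    by (simp add: eq)
qed

text \<open>The vector y solves (\<theta> I - T) y = \<nu> + (L y) t, hence (L y)(1 - a) = b. The
  resolvent identity gives d s (1 - a) = E and d s^2 b = E - s D, whose quotient yields 1 / s - D /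
  E.\<close>

lemma resolvent_G:
  assumes \<Phi>: "\<Phi> \<ge> 0" "\<psi> \<Phi> = q" and L: "L = ((lam / d) *\<^sub>R \<alpha>) v* resolvent T \<Phi>"
    and G: "G = T + outer_prod t L" and inv: "invertible (mat \<theta> - G)"
    and \<theta>: "\<theta> > \<Phi>" "\<psi> \<theta> \<noteq> q"
  shows "L \<bullet> (resolvent G \<theta> *v (resolvent T \<Phi> *v t)) =
    1 / (\<theta> - \<Phi>) - exponent_deriv \<psi> \<Phi> / (\<psi> \<theta> - q)"
proof -
  have \<theta>0: "\<theta> \<ge> 0"
    using \<Phi> \<theta> by simp
  note inv\<Phi> = invertible [OF \<Phi>(1)] and inv\<theta> = invertible [OF \<theta>0]
  define \<nu> where "\<nu> = resolvent T \<Phi> *v t"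
  define y where "y = resolvent G \<theta> *v \<nu>"
  define a where "a = L \<bullet> (resolvent T \<theta> *v t)"
  define b where "b = L \<bullet> (resolvent T \<theta> *v \<nu>)"
  define D where "D = exponent_deriv \<psi> \<Phi>"
  define s where "s = \<theta> - \<Phi>"
  define E where "E = \<psi> \<theta> - q"
  have L_inner: "L \<bullet> v = (lam / d) * (\<alpha> \<bullet> (resolvent T \<Phi> *v v))" for v
    by (simp add: L dot_lmul_matrix)
  have E: "E = d * s + lam * (lt \<theta> - lt \<Phi>)"
    using \<Phi> \<psi>_eq [OF \<Phi>(1)] \<psi>_eq [OF \<theta>0] by (simp add: E_def s_def algebra_simps)
  have "G *v y = \<theta> *\<^sub>R y - \<nu>"
    unfolding y_def by (rule resolvent_right [OF inv])
  then have "\<theta> *\<^sub>R y - T *v y = \<nu> + (L \<bullet> y) *\<^sub>R t"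
    by (simp add: G matrix_vector_mult_add_rdistrib outer_prod_vector_mult algebra_simps)
  then have "y = resolvent T \<theta> *v (\<nu> + (L \<bullet> y) *\<^sub>R t)"
    by (rule resolvent_eqI [OF inv\<theta>])
  from arg_cong [OF this, of "(\<bullet>) L"] have y: "L \<bullet> y = b + (L \<bullet> y) * a"
    by (simp add: a_def b_def matrix_vector_right_distrib matrix_vector_mult_scaleR inner_add_right)
  have "s * (\<alpha> \<bullet> (resolvent T \<Phi> *v (resolvent T \<theta> *v t))) = lt \<Phi> - lt \<theta>"
    using arg_cong [OF resolvent_identity [OF inv\<Phi> inv\<theta>, of t], of "(\<bullet>) \<alpha>"]
    by (simp add: lt_def s_def inner_diff_right)
  then have "s * a = (lam / d) * (lt \<Phi> - lt \<theta>)"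
    by (simp add: a_def L_inner mult.left_commute)
  then have sa: "d * s * (1 - a) = E"
    using d_pos by (simp add: E field_simps)
  have comm: "s * (\<alpha> \<bullet> (resolvent T \<theta> *v \<nu>)) = lt \<Phi> - lt \<theta>"
    using arg_cong [OF resolvent_identity [OF inv\<theta> inv\<Phi>, of t], of "(\<bullet>) \<alpha>"]
    by (simp add: lt_def s_def \<nu>_def inner_diff_right algebra_simps)
  have "s * (\<alpha> \<bullet> (resolvent T \<Phi> *v (resolvent T \<theta> *v \<nu>))) =
      \<alpha> \<bullet> (resolvent T \<Phi> *v \<nu>) - \<alpha> \<bullet> (resolvent T \<theta> *v \<nu>)"
    using arg_cong [OF resolvent_identity [OF inv\<Phi> inv\<theta>, of \<nu>], of "(\<bullet>) \<alpha>"]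
    by (simp add: s_def inner_diff_right)
  then have "s * b = (lam / d) * (\<alpha> \<bullet> (resolvent T \<Phi> *v \<nu>) - \<alpha> \<bullet> (resolvent T \<theta> *v \<nu>))"
    by (simp add: b_def L_inner mult.left_commute)
  then have "d * s * b = lam * (\<alpha> \<bullet> (resolvent T \<Phi> *v \<nu>)) - lam * (\<alpha> \<bullet> (resolvent T \<theta> *v \<nu>))"
    using d_pos by (simp add: field_simps)
  \<comment> \<open>Here the derivative enters: the squared resolvent at \<Phi> is the derivative of
    \<open>lt\<close> up to sign.\<close>
  moreover have "lam * (\<alpha> \<bullet> (resolvent T \<Phi> *v \<nu>)) = d - D"
    using exponent_deriv_eq [OF \<Phi>(1)] by (simp add: D_def \<nu>_def)
  ultimately have dsb: "d * s * b = d - D - lam * (\<alpha> \<bullet> (resolvent T \<theta> *v \<nu>))"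
    by simp
  have "s * (d * s * b) = s * (d - D) - lam * (s * (\<alpha> \<bullet> (resolvent T \<theta> *v \<nu>)))"
    unfolding dsb by (simp add: algebra_simps)
  then have sb: "s * (d * s * b) = E - s * D"
    unfolding comm by (simp add: E algebra_simps)
  have "b = (L \<bullet> y) * (1 - a)"
    using y by (simp add: algebra_simps)
  then have "s * ((L \<bullet> y) * (d * s * (1 - a))) = E - s * D"
    using sb by (simp add: mult_ac)
  then have "s * ((L \<bullet> y) * E) = E - s * D"
    by (simp only: sa)
  moreover have "s \<noteq> 0" "E \<noteq> 0"
    using \<theta> by (simp_all add: s_def E_def)
  ultimately have "L \<bullet> y = 1 / s - D / E"
    by (simp add: field_simps)
  then show ?thesis
    by (simp add: y_def \<nu>_def s_def D_def E_def)
qed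

lemma scale_function_eq:
  assumes q: "q \<ge> 0" and \<Phi>: "\<Phi> = largest_root \<psi> q" and D: "exponent_deriv \<psi> \<Phi> > 0"
    and L: "L = ((lam / d) *\<^sub>R \<alpha>) v* resolvent T \<Phi>" and G: "G = T + outer_prod t L"
    and W: "is_scale_function \<psi> q W" and x: "x \<ge> 0"
  shows "W x = 1 / exponent_deriv \<psi> \<Phi> * (exp (\<Phi> * x) - L \<bullet> flow G x (resolvent T \<Phi> *v t))"
proof -
  have \<Phi>0: "\<Phi> \<ge> 0" "\<psi> \<Phi> = q" and greatest: "\<And>\<theta>. \<theta> \<ge> 0 \<Longrightarrow> \<psi> \<theta> = q \<Longrightarrow> \<theta> \<le> \<Phi>"
    using largest_root_greatest [OF q] \<Phi> by simp_all
  let ?D = "exponent_deriv \<psi> \<Phi>"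
  define \<nu> where "\<nu> = resolvent T \<Phi> *v t"
  \<comment> \<open>Beyond \<Phi> the transform of \<open>W\<close> is prescribed and \<psi> differs
    from q; beyond the operator norm of \<open>G\<close> its flow has a Laplace transform.\<close>
  define \<theta>\<^sub>0 where "\<theta>\<^sub>0 = max \<Phi> (onorm ((*v) G)) + 1"
  define V where "V x = 1 / ?D * (exp (\<Phi> * x) - L \<bullet> flow G x \<nu>)" for x
  have exp_V: "exp (- \<theta> * x) * V x =
      1 / ?D * (exp (- (\<theta> - \<Phi>) * x) - exp (- \<theta> * x) * (L \<bullet> flow G x \<nu>))" for \<theta> x
  proof -
    have "exp (- (\<theta> - \<Phi>) * x) = exp (- \<theta> * x) * exp (\<Phi> * x)"
      by (simp add: algebra_simps flip: exp_add)
    then show ?thesis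
      by (simp add: V_def algebra_simps)
  qed
  have V_int: "(\<lambda>x. exp (- \<theta> * x) * V x) absolutely_integrable_on {0..}"
    and V_lap: "((\<lambda>x. exp (- \<theta> * x) * V x) has_integral 1 / (\<psi> \<theta> - q)) {0..}"
    if "\<theta> \<ge> \<theta>\<^sub>0" for \<theta>
  proof -
    have gt: "\<theta> > \<Phi>" "\<theta> > onorm ((*v) G)"
      using that by (simp_all add: \<theta>\<^sub>0_def)
    moreover have "\<psi> \<theta> \<noteq> q"
      using greatest [of \<theta>] gt(1) \<Phi>0(1) by linarith
    ultimately have \<theta>: "\<theta> > \<Phi>" "\<theta> > onorm ((*v) G)" "\<psi> \<theta> \<noteq> q"
      by simp_all
    note int = laplace_flow_integrable_large [OF \<theta>(2)]
    have exp_int: "((\<lambda>x. exp (- (\<theta> - \<Phi>) * x)) has_integral 1 / (\<theta> - \<Phi>)) {0..}"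
      using has_integral_exp_minus_to_infinity [of "\<theta> - \<Phi>" 0] \<theta>(1) by simp
    then have "(\<lambda>x. exp (- (\<theta> - \<Phi>) * x)) absolutely_integrable_on {0..}"
      by (intro nonnegative_absolutely_integrable_1) auto
    then show "(\<lambda>x. exp (- \<theta> * x) * V x) absolutely_integrable_on {0..}"
      unfolding exp_V by (intro set_integrable_mult_right set_integral_diff(1) int)
    have "L \<bullet> (resolvent G \<theta> *v \<nu>) = 1 / (\<theta> - \<Phi>) - ?D / (\<psi> \<theta> - q)"
      unfolding \<nu>_def using resolvent_G [OF \<Phi>0 L G invertible_mat_minus_large [OF \<theta>(2)] \<theta>(1,3)] .
    then have "1 / ?D * (1 / (\<theta> - \<Phi>) - L \<bullet> (resolvent G \<theta> *v \<nu>)) = 1 / (\<psi> \<theta> - q)"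
      using D by simp
    moreover have "((\<lambda>x. exp (- \<theta> * x) * V x) has_integral
        1 / ?D * (1 / (\<theta> - \<Phi>) - L \<bullet> (resolvent G \<theta> *v \<nu>))) {0..}"
      unfolding exp_V by (intro has_integral_mult_right has_integral_diff exp_int laplace_flow int)
    ultimately show "((\<lambda>x. exp (- \<theta> * x) * V x) has_integral 1 / (\<psi> \<theta> - q)) {0..}"
      by simp
  qed
  have W_nonneg: "\<And>x. 0 \<le> W x" and W_cont: "continuous_on {0..} W"
    and W_lap: "\<And>\<theta>. \<theta> > \<Phi> \<Longrightarrow> ((\<lambda>x. exp (- \<theta> * x) * W x) has_integral 1 / (\<psi> \<theta> - q)) {0..}"
    using W by (auto simp: is_scale_function_def \<Phi>)
  have "W x = V x"
  proof (rule laplace_transform_unique [where f = W and g = V and x = x and \<theta> = \<theta>\<^sub>0 and I = "\<lambda>\<theta>. 1 / (\<psi> \<theta> - q)"])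
    show "continuous_on {0..} V"
      unfolding V_def by (intro continuous_intros continuous_on_inner_flow)
    have "((\<lambda>x. exp (- \<theta>\<^sub>0 * x) * W x) has_integral 1 / (\<psi> \<theta>\<^sub>0 - q)) {0..}"
      by (rule W_lap) (simp add: \<theta>\<^sub>0_def)
    \<comment> \<open>Nonnegativity of the scale function upgrades integrability to absolute
      integrability.\<close>
    then show "(\<lambda>x. exp (- \<theta>\<^sub>0 * x) * W x) absolutely_integrable_on {0..}"
      by (intro nonnegative_absolutely_integrable_1) (auto simp: W_nonneg)
    show "((\<lambda>x. exp (- \<eta> * x) * W x) has_integral 1 / (\<psi> \<eta> - q)) {0..}" if "\<theta>\<^sub>0 \<le> \<eta>" for \<eta>
      using that by (intro W_lap) (simp add: \<theta>\<^sub>0_def)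
  qed (use V_int V_lap W_cont x in auto)
  then show ?thesis
    by (simp add: V_def \<nu>_def)
qed

end

theorem theorem2p2:
  fixes M :: "'a measure"
    and N :: "real \<Rightarrow> 'a \<Rightarrow> nat"
    and C :: "nat \<Rightarrow> 'a \<Rightarrow> real"
    and X :: "real \<Rightarrow> 'a \<Rightarrow> real"
    and \<alpha> t :: "real^'p"
    and T :: "real^'p^'p"
    and d lam q \<Phi> :: real
    and \<psi> :: "real \<Rightarrow> real"
    and Psi :: "nat \<Rightarrow> real^'p"
  assumes "prob_space M"
    and "d > 0" and "lam > 0"
    and "poisson_process M N lam"
    and "prob_space.indep_vars M (\<lambda>_. borel) C {1..}"
    and "\<And>j. 1 \<le> j \<Longrightarrow> matrix_exponential_rv M (C j) \<alpha> T t"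
    and "indep_count_claims M N C"
    and "standardized_rep \<alpha> T t"
    and "minimal_rep \<alpha> T t"
    and "X = risk_process d N C"
    and "\<psi> = laplace_exponent M X"
    and "q \<ge> 0"
    and "\<Phi> = largest_root \<psi> q"
    and "exponent_deriv \<psi> \<Phi> > 0"
    and "Psi 0 = 0"
    and "\<And>n. Psi (Suc n) =
           ((lam / d) *\<^sub>R \<alpha> + (Psi n \<bullet> t) *\<^sub>R Psi n) v* matrix_inv (mat ((lam + q) / d) - T)"
  shows "\<exists>L :: real^'p.
           (\<forall>i. (\<lambda>n. Psi n $ i) \<longlonglongrightarrow> L $ i) \<and>
           L v* (mat (lam + q) - d *\<^sub>R T - d *\<^sub>R outer_prod t L) = lam *\<^sub>R \<alpha> \<and>
           (\<forall>W. is_scale_function \<psi> q W \<longrightarrow>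
              (let G = T + outer_prod t L;
                   \<nu> = matrix_inv (mat \<Phi> - T) *v t
               in \<forall>x\<ge>0. W x =
                    1 / exponent_deriv \<psi> \<Phi> * (exp (\<Phi> * x) - L \<bullet> (mat_exp (x *\<^sub>R G) *v \<nu>))))"
proof -
  interpret poisson_process M N lam by fact
  interpret me_law \<alpha> t T
    using assms(1,9) assms(6) [of 1] by (intro me_law_matrix_exponential_rv) auto
  interpret me_exponent \<alpha> t T d lam \<psi>
  proof
    fix \<theta> :: real
    assume "\<theta> \<ge> 0"
    then have "expectation (\<lambda>\<omega>. exp (\<theta> * X 1 \<omega>)) = exp (d * \<theta> + lam * (lt \<theta> - 1))"
      unfolding assms(10)
      by (intro compound_poisson_mgf assms(5,7) matrix_exponential_rv_mgf assms(6))
    then show "\<psi> \<theta> = d * \<theta> + lam * (lt \<theta> - 1)"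
      by (simp add: assms(11) laplace_exponent_def)
  qed fact+
  note root = largest_root_greatest [OF \<open>q \<ge> 0\<close>, folded \<open>\<Phi> = largest_root \<psi> q\<close>]
  define L where "L = ((lam / d) *\<^sub>R \<alpha>) v* resolvent T \<Phi>"
  \<comment> \<open>This is the form of \<psi>(\<theta>) = q that the iteration lemma
    expects.\<close>
  have root_iff: "(lam + q) / d - \<theta> = lam / d * lt \<theta> \<longleftrightarrow> \<psi> \<theta> = q" if "\<theta> \<ge> 0" for \<theta>
    using \<open>d > 0\<close> that by (auto simp: \<psi>_eq field_simps)
  have "Psi \<longlonglongrightarrow> L"
    unfolding L_def
  proof (rule riccati_iteration_tendsto)
    show "(lam + q) / d - \<Phi> = lam / d * lt \<Phi>"
      using root(1,2) root_iff by blast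
    show "\<gamma> = \<Phi>" if "\<gamma> \<ge> \<Phi>" "(lam + q) / d - \<gamma> = lam / d * lt \<gamma>" for \<gamma>
      using that root(1) root(3) [of \<gamma>] root_iff [of \<gamma>] by simp
    show "Psi (Suc n) = ((lam / d) *\<^sub>R \<alpha> + (Psi n \<bullet> t) *\<^sub>R Psi n) v* resolvent T ((lam + q) / d)" for n
      unfolding resolvent_def by (rule assms(16))
  qed (use assms root in auto)
  moreover have "L v* (mat (lam + q) - d *\<^sub>R T - d *\<^sub>R outer_prod t L) = lam *\<^sub>R \<alpha>"
    using root(1,2) L_def by (rule riccati_solution)
  moreover have "W x = 1 / exponent_deriv \<psi> \<Phi> *
      (exp (\<Phi> * x) - L \<bullet> (mat_exp (x *\<^sub>R (T + outer_prod t L)) *v (matrix_inv (mat \<Phi> - T) *v t)))"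
    if "is_scale_function \<psi> q W" "x \<ge> 0" for W x
    using scale_function_eq [OF assms(12,13,14) L_def refl that] by (simp add: flow_def resolvent_def)
  ultimately show ?thesis
    by (intro exI [of _ L]) (auto simp: Let_def intro: tendsto_vec_nth)
qed

end
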